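(* Let $\mathcal{G}$ be a countable family of analytic hypergraphs on a Polish space $X$ with the small anticlique property, such that all edges in all hypergraphs in $\mathcal{G}$ are finite. If the quotient poset $P_{I_{\mathcal{G}}}$ is proper, then it does not add an independent real.
   Context: For a Polish space $X$, $X^{\leq\omega}$ denotes the space of all finite sequences and all $\omega$-sequences of elements of $X$. A hypergraph on $X$ is a set $G\subset X^{\leq\omega}$; its elements are called edges. $G$ is analytic if it is an analytic subset of $X^{\leq\omega}$. A $G$-anticlique is a set $B\subset X$ with $B^{\leq\omega}\cap G=\emptyset$. For a countable collection $\mathcal{G}$ of hypergraphs on $X$, $I_{\mathcal{G}}$ is the $\sigma$-ideal on $X$ $\sigma$-generated by the Borel sets which are anticliques in at least one of the hypergraphs in $\mathcal{G}$; a set is $I_{\mathcal{G}}$-positive if it is not in $I_{\mathcal{G}}$. $P_{I_{\mathcal{G}}}$ is the poset of Borel $I_{\mathcal{G}}$-positive sets ordered by inclusion. A countable collection $\mathcal{G}$ of analytic hypergraphs on $X$ has the small anticlique property if for every sequence $\langle B_n,G_n\colon n\in\omega\rangle$ such that $G_n\in\mathcal{G}$ and $B_n\subset X$ is an arbitrary (not necessarily Borel) $G_n$-anticlique, the union $\bigcup_nB_n$ does not contain an analytic $I_{\mathcal{G}}$-positive subset. A function $x\in 2^\omega$ is an independent real over a model of ZFC if no infinite subfunction of $x$ (restriction of $x$ to an infinite subset of $\omega$) belongs to that model. A poset adds an independent real if some condition forces the existence of an independent real over the ground model. *)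

theory Defs
  imports "HOL-Analysis.Analysis" "HOL-Library.Countable_Set"
begin

section \<open>Analytic hypergraphs and their ideals\<close>

text \<open>A sequence of length \<open>n \<le> \<omega>\<close> is the pair of \<open>n\<close> and a function that is \<^const>\<open>undefined\<close>
  outside \<open>{i. i < n}\<close>. The space of these sequences is the topological sum of the powers
  \<open>X\<^sup>n\<close>, \<open>n \<le> \<omega>\<close>. The empty sequence is a finite sequence.\<close>

type_synonym 'a hypergraph = "(enat \<times> (nat \<Rightarrow> 'a)) set"

definition seqs :: "'a set \<Rightarrow> (enat \<times> (nat \<Rightarrow> 'a)) set" where
  "seqs B = Sigma UNIV (\<lambda>n. {i. enat i < n} \<rightarrow>\<^sub>E B)"

definition seq_topology :: "(enat \<times> (nat \<Rightarrow> 'a::topological_space)) topology" where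
  "seq_topology = sum_topology (\<lambda>n. product_topology (\<lambda>_. euclidean) {i. enat i < n}) UNIV"

lemma topspace_seq_topology: "topspace seq_topology = seqs UNIV"
  by (simp add: seq_topology_def seqs_def comp_def)

text \<open>Analytic sets are the continuous images of the Baire space, together with the empty set.\<close>

definition analytic_in :: "'b topology \<Rightarrow> 'b set \<Rightarrow> bool" where
  "analytic_in Y A \<longleftrightarrow>
     A = {} \<or> (\<exists>f. continuous_map (euclidean :: (nat \<Rightarrow> nat) topology) Y f \<and> range f = A)"

definition anticlique :: "'a hypergraph \<Rightarrow> 'a set \<Rightarrow> bool" where
  "anticlique G B \<longleftrightarrow> seqs B \<inter> G = {}"

definition hypergraph_ideal :: "'a::topological_space hypergraph set \<Rightarrow> 'a set set" where
  "hypergraph_ideal \<G> =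
     {A. \<exists>F. countable F \<and> F \<subseteq> {B \<in> sets borel. \<exists>G\<in>\<G>. anticlique G B} \<and> A \<subseteq> \<Union>F}"

definition quotient_poset :: "'a::topological_space set set \<Rightarrow> 'a set set" where
  "quotient_poset I = sets borel - I"

definition small_anticlique_property :: "'a::topological_space hypergraph set \<Rightarrow> bool" where
  "small_anticlique_property \<G> \<longleftrightarrow>
     (\<forall>(B :: nat \<Rightarrow> 'a set) (G :: nat \<Rightarrow> 'a hypergraph).
        (\<forall>n. G n \<in> \<G> \<and> anticlique (G n) (B n)) \<longrightarrow>
        \<not> (\<exists>A. analytic_in euclidean A \<and> A \<subseteq> (\<Union>n. B n) \<and> A \<notin> hypergraph_ideal \<G>))"

section \<open>Hereditarily small sets\<close>

text \<open>A well-founded tree whose nodes have at most \<open>|'k|\<close> immediate subtrees denotes the set of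
  the sets denoted by its immediate subtrees. For infinite \<open>'k\<close> the trees modulo equality of the
  denoted sets form \<open>H\<^sub>\<theta>\<close>, where \<open>\<theta>\<close> is the cardinal successor of \<open>|'k|\<close>; this is
  the content of the lemmas \<open>wf_hmem\<close>, \<open>elts_inject\<close> and \<open>range_elts\<close> below.\<close>

datatype 'k tree = Node "'k \<Rightarrow> 'k tree option"

fun subtrees :: "'k tree \<Rightarrow> 'k tree set" where
  "subtrees (Node f) = ran f"

inductive tree_eq :: "'k tree \<Rightarrow> 'k tree \<Rightarrow> bool" where
  tree_eqI: "(\<forall>s'\<in>subtrees s. \<exists>t'\<in>subtrees t. tree_eq s' t') \<Longrightarrow>
    (\<forall>t'\<in>subtrees t. \<exists>s'\<in>subtrees s. tree_eq s' t') \<Longrightarrow> tree_eq s t"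

lemma tree_subtrees_induct:
  assumes "\<And>t. (\<And>s. s \<in> subtrees t \<Longrightarrow> P s) \<Longrightarrow> P t"
  shows "P t"
proof (induction t)
  case (Node f)
  show ?case
  proof (rule assms)
    fix s assume "s \<in> subtrees (Node f)"
    then obtain k where "f k = Some s" by (auto simp: ran_def)
    then show "P s" by (intro Node[of "f k" s]) (auto intro: range_eqI[OF sym])
  qed
qed

lemma tree_eqD:
  assumes "tree_eq s t"
  shows "s' \<in> subtrees s \<Longrightarrow> \<exists>t'\<in>subtrees t. tree_eq s' t'"
    and "t' \<in> subtrees t \<Longrightarrow> \<exists>s'\<in>subtrees s. tree_eq s' t'"
  using assms by (auto elim: tree_eq.cases)

lemma tree_eq_refl: "tree_eq t t"
proof (induction t rule: tree_subtrees_induct)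
  case (1 t)
  show ?case by (rule tree_eqI) (intro ballI bexI, rule 1, assumption+)+
qed

lemma tree_eq_sym: "tree_eq s t \<Longrightarrow> tree_eq t s"
proof (induction rule: tree_eq.induct)
  case (tree_eqI s t)
  show ?case by (rule tree_eq.tree_eqI) (use tree_eqI in blast)+
qed

lemma tree_eq_trans: "tree_eq s t \<Longrightarrow> tree_eq t u \<Longrightarrow> tree_eq s u"
proof (induction s arbitrary: t u rule: tree_subtrees_induct)
  case (1 s)
  show ?case
  proof (rule tree_eqI; intro ballI)
    fix s' assume s': "s' \<in> subtrees s"
    then obtain t' where t': "t' \<in> subtrees t" "tree_eq s' t'"
      using tree_eqD(1)[OF 1(2)] by blast
    then obtain u' where "u' \<in> subtrees u" "tree_eq t' u'"
      using tree_eqD(1)[OF 1(3)] by blast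
    then show "\<exists>u'\<in>subtrees u. tree_eq s' u'"
      using 1(1)[OF s' t'(2)] by blast
  next
    fix u' assume "u' \<in> subtrees u"
    then obtain t' where t': "t' \<in> subtrees t" "tree_eq t' u'"
      using tree_eqD(2)[OF 1(3)] by blast
    then obtain s' where "s' \<in> subtrees s" "tree_eq s' t'"
      using tree_eqD(2)[OF 1(2)] by blast
    then show "\<exists>s'\<in>subtrees s. tree_eq s' u'"
      using 1(1) t'(2) by blast
  qed
qed

quotient_type 'k hset = "'k tree" / tree_eq
  by (intro equivpI reflpI sympI transpI)
    (fact tree_eq_refl, erule tree_eq_sym, erule (1) tree_eq_trans)

lift_definition hmem :: "'k hset \<Rightarrow> 'k hset \<Rightarrow> bool"
  is "\<lambda>s t. \<exists>t'\<in>subtrees t. tree_eq s t'"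
proof -
  fix s s2 t t2 :: "'k tree"
  have *: "\<exists>t'\<in>subtrees v. tree_eq y t'"
    if xy: "tree_eq x y" and uv: "tree_eq u v" and ex: "\<exists>t'\<in>subtrees u. tree_eq x t'" for x y u v :: "'k tree"
  proof -
    from ex obtain u' where u': "u' \<in> subtrees u" "tree_eq x u'" by blast
    obtain v' where v': "v' \<in> subtrees v" "tree_eq u' v'"
      using tree_eqD(1)[OF uv u'(1)] by blast
    have "tree_eq y v'"
      by (rule tree_eq_trans[OF tree_eq_sym[OF xy] tree_eq_trans[OF u'(2) v'(2)]])
    with v'(1) show ?thesis by blast
  qed
  assume "tree_eq s s2" "tree_eq t t2"
  then show "(\<exists>t'\<in>subtrees t. tree_eq s t') = (\<exists>t'\<in>subtrees t2. tree_eq s2 t')"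
    using * tree_eq_sym by (intro iffI) blast+
qed

definition elts :: "'k hset \<Rightarrow> 'k hset set" where
  "elts y = {x. hmem x y}"

lemma elts_inject: "elts x = elts y \<longleftrightarrow> x = y"
proof
  assume "elts x = elts y"
  then have "\<forall>z. hmem z x \<longleftrightarrow> hmem z y" by (auto simp: elts_def)
  then show "x = y"
  proof transfer
    fix s t :: "'a tree"
    assume *: "\<forall>u. (\<exists>s'\<in>subtrees s. tree_eq u s') = (\<exists>t'\<in>subtrees t. tree_eq u t')"
    show "tree_eq s t"
    proof (rule tree_eqI; intro ballI)
      fix s' assume "s' \<in> subtrees s"
      then show "\<exists>t'\<in>subtrees t. tree_eq s' t'" using * tree_eq_refl[of s'] by blast
    next
      fix t' assume "t' \<in> subtrees t"
      then have "\<exists>s'\<in>subtrees s. tree_eq t' s'" using * tree_eq_refl[of t'] by blast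
      then show "\<exists>s'\<in>subtrees s. tree_eq s' t'" using tree_eq_sym by blast
    qed
  qed
qed auto

lemma wf_hmem: "wf {(x, y :: 'k hset). hmem x y}"
proof -
  have "P y" if *: "\<And>y. (\<And>x. hmem x y \<Longrightarrow> P x) \<Longrightarrow> P y" for P and y :: "'k hset"
  proof (induction y rule: hset.abs_induct)
    case (1 t)
    have "\<forall>s. tree_eq t s \<longrightarrow> P (abs_hset s)"
    proof (induction t rule: tree_subtrees_induct)
      case (1 t)
      show ?case
      proof (intro allI impI)
        fix s assume "tree_eq t s"
        then have eq: "abs_hset s = abs_hset t"
          by (metis hset.abs_eq_iff)
        show "P (abs_hset s)"
        proof (rule *)
          fix x assume "hmem x (abs_hset s)"
          then have "hmem (abs_hset (rep_hset x)) (abs_hset t)"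
            by (simp add: eq Quotient_abs_rep[OF Quotient_hset])
          then obtain t' where "t' \<in> subtrees t" "tree_eq (rep_hset x) t'"
            by (auto simp: hmem.abs_eq)
          then have "P (abs_hset (rep_hset x))" using 1 tree_eq_sym by blast
          then show "P x" by (simp add: Quotient_abs_rep[OF Quotient_hset])
        qed
      qed
    qed
    then show ?case using tree_eq_refl by blast
  qed
  note induct = this
  show ?thesis
    unfolding wf_def
  proof (intro allI impI)
    fix P :: "'k hset \<Rightarrow> bool" and x
    assume "\<forall>x. (\<forall>y. (y, x) \<in> {(x, y). hmem x y} \<longrightarrow> P y) \<longrightarrow> P x"
    then show "P x" by (intro induct[of P x]) simp
  qed
qed

lemma range_elts:
  includes cardinal_syntax
  shows "range elts = {S :: 'k hset set. |S| \<le>o |UNIV :: 'k set|}"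
proof (intro set_eqI iffI; clarsimp)
  fix y :: "'k hset"
  obtain f where f: "y = abs_hset (Node f)"
    by (metis Quotient_abs_rep[OF Quotient_hset] tree.exhaust)
  have "elts y \<subseteq> (\<lambda>k. abs_hset (the (f k))) ` UNIV"
  proof
    fix x assume "x \<in> elts y"
    then have "hmem (abs_hset (rep_hset x)) (abs_hset (Node f))"
      by (simp add: elts_def f Quotient_abs_rep[OF Quotient_hset])
    then obtain t' where t: "t' \<in> ran f" "tree_eq (rep_hset x) t'"
      by (auto simp: hmem.abs_eq)
    then obtain k where "f k = Some t'" by (auto simp: ran_def)
    moreover have "x = abs_hset t'"
      using t(2) by (metis Quotient_abs_rep[OF Quotient_hset] hset.abs_eq_iff)
    ultimately show "x \<in> (\<lambda>k. abs_hset (the (f k))) ` UNIV"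
      by (metis option.sel rangeI)
  qed
  then show "|elts y| \<le>o |UNIV :: 'k set|"
    by (meson card_of_image card_of_mono1 ordLeq_transitive)
next
  fix S :: "'k hset set"
  assume "|S| \<le>o |UNIV :: 'k set|"
  then obtain g :: "'k hset \<Rightarrow> 'k" where g: "inj_on g S"
    by (auto simp: card_of_ordLeq[symmetric])
  define f where
    "f k = (if k \<in> g ` S then Some (rep_hset (inv_into S g k)) else None)" for k
  have ran: "ran f = rep_hset ` S"
  proof -
    have "ran f = (\<lambda>k. rep_hset (inv_into S g k)) ` (g ` S)"
      by (auto simp: ran_def f_def)
    also have "\<dots> = rep_hset ` S"
      unfolding image_image by (rule image_cong) (simp_all add: g)
    finally show ?thesis .
  qed
  have "elts (abs_hset (Node f)) = S"
  proof (intro set_eqI)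
    fix x
    have "x \<in> elts (abs_hset (Node f)) \<longleftrightarrow> hmem (abs_hset (rep_hset x)) (abs_hset (Node f))"
      by (simp add: elts_def Quotient_abs_rep[OF Quotient_hset])
    also have "\<dots> \<longleftrightarrow> (\<exists>y\<in>S. tree_eq (rep_hset x) (rep_hset y))"
      by (simp add: hmem.abs_eq ran)
    also have "\<dots> \<longleftrightarrow> x \<in> S"
      by (metis Quotient_rel_rep[OF Quotient_hset])
    finally show "x \<in> elts (abs_hset (Node f)) \<longleftrightarrow> x \<in> S" .
  qed
  then show "S \<in> range elts" by blast
qed

text \<open>Only meaningful for sets of size at most \<open>|'k|\<close>.\<close>

definition HSet :: "'k hset set \<Rightarrow> 'k hset" where
  "HSet S = (THE y. elts y = S)"

lemma elts_HSet:
  includes cardinal_syntax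
  fixes S :: "'k hset set"
  shows "|S| \<le>o |UNIV :: 'k set| \<Longrightarrow> elts (HSet S) = S"
  unfolding HSet_def
proof (rule theI')
  assume "|S| \<le>o |UNIV :: 'k set|"
  then have "S \<in> range elts" by (simp add: range_elts)
  then show "\<exists>!y. elts y = S" by (auto simp: elts_inject)
qed

definition hpair :: "'k hset \<Rightarrow> 'k hset \<Rightarrow> 'k hset" where
  "hpair x y = HSet {HSet {x}, HSet {x, y}}"

section \<open>Elementary submodels\<close>

datatype fmla = Mem nat nat | Eq nat nat | Neg fmla | Conj fmla fmla | All nat fmla

primrec sat :: "'k hset set \<Rightarrow> fmla \<Rightarrow> (nat \<Rightarrow> 'k hset) \<Rightarrow> bool" where
  "sat M (Mem i j) v \<longleftrightarrow> hmem (v i) (v j)"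
| "sat M (Eq i j) v \<longleftrightarrow> v i = v j"
| "sat M (Neg \<phi>) v \<longleftrightarrow> \<not> sat M \<phi> v"
| "sat M (Conj \<phi> \<psi>) v \<longleftrightarrow> sat M \<phi> v \<and> sat M \<psi> v"
| "sat M (All i \<phi>) v \<longleftrightarrow> (\<forall>x\<in>M. sat M \<phi> (v(i := x)))"

definition elementary :: "'k hset set \<Rightarrow> bool" where
  "elementary M \<longleftrightarrow>
     M \<noteq> {} \<and> (\<forall>\<phi> v. range v \<subseteq> M \<longrightarrow> (sat M \<phi> v \<longleftrightarrow> sat UNIV \<phi> v))"

section \<open>Proper forcing\<close>

definition dense_in :: "'p set \<Rightarrow> ('p \<Rightarrow> 'p \<Rightarrow> bool) \<Rightarrow> 'p set \<Rightarrow> bool" where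
  "dense_in P le D \<longleftrightarrow> D \<subseteq> P \<and> (\<forall>p\<in>P. \<exists>d\<in>D. le d p)"

definition predense_below :: "'p set \<Rightarrow> ('p \<Rightarrow> 'p \<Rightarrow> bool) \<Rightarrow> 'p \<Rightarrow> 'p set \<Rightarrow> bool" where
  "predense_below P le q E \<longleftrightarrow>
     (\<forall>r\<in>P. le r q \<longrightarrow> (\<exists>d\<in>E. \<exists>s\<in>P. le s r \<and> le s d))"

text \<open>Since the conditions need not be hereditarily small sets, \<open>c\<close> replaces the poset by an
  isomorphic copy in \<open>H\<^sub>\<theta>\<close>.\<close>

definition generic_condition ::
    "'p set \<Rightarrow> ('p \<Rightarrow> 'p \<Rightarrow> bool) \<Rightarrow> ('p \<Rightarrow> 'k hset) \<Rightarrow> 'k hset set \<Rightarrow> 'p \<Rightarrow> bool" where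
  "generic_condition P le c M q \<longleftrightarrow>
     (\<forall>D. dense_in P le D \<and> HSet (c ` D) \<in> M \<longrightarrow> predense_below P le q {d \<in> D. c d \<in> M})"

text \<open>Here \<open>\<theta>\<close> is the cardinal successor of \<open>|('p + nat) set|\<close>, so it is regular and
  \<open>\<theta> > 2\<^bsup>|P|\<^esup>\<close>. As usual, this is large enough: whether a poset is proper does not depend on the
  choice of such a \<open>\<theta>\<close>. It does not depend on the isomorphic copy either, and the lemma
  \<open>ex_hset_copy\<close> shows that there is one.\<close>

definition proper_forcing :: "'p set \<Rightarrow> ('p \<Rightarrow> 'p \<Rightarrow> bool) \<Rightarrow> bool" where
  "proper_forcing P le \<longleftrightarrow>
     (\<forall>(c :: 'p \<Rightarrow> ('p + nat) set hset) M.
        inj_on c P \<and> countable M \<and> elementary M \<and>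
        HSet (c ` P) \<in> M \<and> HSet {hpair (c p) (c q) |p q. p \<in> P \<and> q \<in> P \<and> le p q} \<in> M \<longrightarrow>
        (\<forall>p\<in>P. c p \<in> M \<longrightarrow> (\<exists>q\<in>P. le q p \<and> generic_condition P le c M q)))"

lemma ex_hset_copy:
  includes cardinal_syntax
  shows "\<exists>c :: 'p \<Rightarrow> ('p + nat) set hset. inj c"
proof -
  obtain r :: "'p rel" where r: "well_order_on UNIV r"
    using well_order_on by blast
  define R where "R = r - Id"
  have wf: "wf R" using r by (simp add: R_def well_order_on_def)
  have total: "(x, y) \<in> R \<or> (y, x) \<in> R" if "x \<noteq> y" for x y
    using r that by (auto simp: R_def well_order_on_def linear_order_on_def total_on_def)
  define c :: "'p \<Rightarrow> ('p + nat) set hset" where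
    "c = wfrec R (\<lambda>c x. HSet (c ` {y. (y, x) \<in> R}))"
  have c: "c x = HSet (c ` {y. (y, x) \<in> R})" for x
  proof -
    have "c x = HSet (cut c R x ` {y. (y, x) \<in> R})"
      using wfrec[OF wf, of "\<lambda>c x. HSet (c ` {y. (y, x) \<in> R})" x] by (simp add: c_def)
    also have "cut c R x ` {y. (y, x) \<in> R} = c ` {y. (y, x) \<in> R}"
      by (auto simp: cut_apply intro!: image_eqI)
    finally show ?thesis .
  qed
  have small: "|c ` A| \<le>o |UNIV :: ('p + nat) set set|" for A
  proof -
    have "|c ` A| \<le>o |UNIV :: 'p set|"
      by (meson card_of_image card_of_mono1 ordLeq_transitive subset_UNIV)
    also have "|UNIV :: 'p set| \<le>o |UNIV :: ('p + nat) set set|"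
      by (rule card_of_ordLeqI[of "\<lambda>x. {Inl x}"]) (auto simp: inj_on_def)
    finally show ?thesis .
  qed
  have mem: "hmem (c y) (c x)" if "(y, x) \<in> R" for x y
    using elts_HSet[OF small, of "{y. (y, x) \<in> R}"] that c[of x] by (auto simp: elts_def)
  have irrefl: "\<not> hmem x x" for x :: "('p + nat) set hset"
    using wf_not_refl[OF wf_hmem, of x] by simp
  have "inj c"
    by (rule injI) (metis total mem irrefl)
  then show ?thesis by blast
qed

section \<open>Independent reals\<close>

text \<open>A name for a subset of a ground model set \<open>'b\<close> is a set of pairs of an element of \<open>'b\<close> and a
  condition; every subset of \<open>'b\<close> in the generic extension has such a name. A statement of the
  forcing language is identified with the predicate of the conditions that force it, and the
  following are the usual clauses of the forcing relation.\<close>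

type_synonym ('b, 'p) name = "('b \<times> 'p) set"

definition forces_mem ::
    "'p set \<Rightarrow> ('p \<Rightarrow> 'p \<Rightarrow> bool) \<Rightarrow> 'b \<Rightarrow> ('b, 'p) name \<Rightarrow> 'p \<Rightarrow> bool" where
  "forces_mem P le x \<tau> p \<longleftrightarrow>
     (\<forall>q\<in>P. le q p \<longrightarrow> (\<exists>r\<in>P. le r q \<and> (\<exists>s. (x, s) \<in> \<tau> \<and> le r s)))"

definition forces_not ::
    "'p set \<Rightarrow> ('p \<Rightarrow> 'p \<Rightarrow> bool) \<Rightarrow> ('p \<Rightarrow> bool) \<Rightarrow> 'p \<Rightarrow> bool" where
  "forces_not P le \<phi> p \<longleftrightarrow> (\<forall>q\<in>P. le q p \<longrightarrow> \<not> \<phi> q)"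

definition forces_all :: "'c set \<Rightarrow> ('c \<Rightarrow> 'p \<Rightarrow> bool) \<Rightarrow> 'p \<Rightarrow> bool" where
  "forces_all A \<phi> p \<longleftrightarrow> (\<forall>a\<in>A. \<phi> a p)"

definition forces_ex ::
    "'p set \<Rightarrow> ('p \<Rightarrow> 'p \<Rightarrow> bool) \<Rightarrow> 'c set \<Rightarrow> ('c \<Rightarrow> 'p \<Rightarrow> bool) \<Rightarrow> 'p \<Rightarrow> bool" where
  "forces_ex P le A \<phi> p \<longleftrightarrow> (\<forall>q\<in>P. le q p \<longrightarrow> (\<exists>r\<in>P. le r q \<and> (\<exists>a\<in>A. \<phi> a r)))"

text \<open>The condition \<open>p\<close> forces that \<open>\<tau>\<close> is (the graph of) a function from \<open>\<omega>\<close> to \<open>2\<close>.\<close>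

definition forces_real ::
    "'p set \<Rightarrow> ('p \<Rightarrow> 'p \<Rightarrow> bool) \<Rightarrow> (nat \<times> bool, 'p) name \<Rightarrow> 'p \<Rightarrow> bool" where
  "forces_real P le \<tau> p \<longleftrightarrow>
     forces_all UNIV (\<lambda>n. forces_ex P le UNIV (\<lambda>i. forces_mem P le (n, i) \<tau>)) p \<and>
     forces_all UNIV (\<lambda>n. forces_not P le
       (forces_all UNIV (\<lambda>i. forces_mem P le (n, i) \<tau>))) p"

text \<open>The condition \<open>p\<close> forces that no infinite partial function from \<open>\<omega>\<close> to \<open>2\<close> in the ground
  model is a subset of \<open>\<tau>\<close>.\<close>

definition forces_independent ::
    "'p set \<Rightarrow> ('p \<Rightarrow> 'p \<Rightarrow> bool) \<Rightarrow> (nat \<times> bool, 'p) name \<Rightarrow> 'p \<Rightarrow> bool" where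
  "forces_independent P le \<tau> p \<longleftrightarrow>
     forces_all {y :: nat \<rightharpoonup> bool. infinite (dom y)}
       (\<lambda>y. forces_not P le (forces_all (Map.graph y) (\<lambda>e. forces_mem P le e \<tau>))) p"

text \<open>By the maximum principle, a condition forces that an independent real exists iff it forces
  some name to be one.\<close>

definition adds_independent_real :: "'p set \<Rightarrow> ('p \<Rightarrow> 'p \<Rightarrow> bool) \<Rightarrow> bool" where
  "adds_independent_real P le \<longleftrightarrow>
     (\<exists>p\<in>P. \<exists>\<tau> \<subseteq> UNIV \<times> P. forces_real P le \<tau> p \<and> forces_independent P le \<tau> p)"

end

theory Submission
  imports Defs
begin

text \<open>Properness is used only to read a name for a real \<open>x \<in> 2\<^sup>\<omega>\<close> in a Borel way: there are a positive
  Borel set \<open>q\<close> and Borel sets \<open>Z n b\<close> with \<open>q \<subseteq> Z n True \<union> Z n False\<close> such that every condition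
  contained in \<open>Z n b\<close> forces \<open>x n = b\<close>. It then suffices to find \<open>b\<close> and an infinite set \<open>Y\<close>
  for which \<open>q \<inter> (\<Inter>n\<in>Y. Z n b)\<close> is positive.

  Choose \<open>f\<^sub>n : q \<rightarrow> 2\<close> with \<open>v \<in> Z n (f\<^sub>n v)\<close> for all \<open>v \<in> q\<close>. A cluster point \<open>g\<close> of the sequence \<open>f\<close> in
  the compact space \<open>2\<^sup>q\<close> splits \<open>q\<close> into two sets, usually not Borel, such that for any finitely
  many points of \<open>{g = b}\<close> there are infinitely many \<open>n\<close> with \<open>f\<^sub>n = b\<close> at all of them. By the small
  anticlique property one of the two sets is not covered by countably many arbitrary anticliques.
  From that set, a fusion argument in the style of the \<open>G\<^sub>0\<close>-dichotomy of Kechris, Solecki and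
  Todorcevic builds \<open>Y\<close> together with a continuous image of the Baire space inside
  \<open>q \<inter> (\<Inter>n\<in>Y. Z n b)\<close>. Each stage handles finitely many points only, since all edges are finite, so
  the next element of \<open>Y\<close> can be found. The image contains so many edges that, by the Baire
  property, it is not covered by countably many Borel anticliques.\<close>

section \<open>The Baire space\<close>

text \<open>The discrete metric makes the Baire space \<^typ>\<open>nat \<Rightarrow> nat\<close> an instance of \<^class>\<open>polish_space\<close>.\<close>

instantiation nat :: metric_space
begin

definition dist_nat :: "nat \<Rightarrow> nat \<Rightarrow> real" where
  "dist_nat m n = (if m = n then 0 else 1)"

definition uniformity_nat :: "(nat \<times> nat) filter" where
  "uniformity_nat = (INF e\<in>{0 <..}. principal {(x, y). dist x y < e})"

instance
proof
  show "open U = (\<forall>x\<in>U. \<forall>\<^sub>F (x', y) in uniformity. x' = x \<longrightarrow> y \<in> U)" for U :: "nat set"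
  proof -
    have "\<forall>\<^sub>F (x', y) in uniformity. x' = x \<longrightarrow> y \<in> U" if "x \<in> U" for x
      unfolding uniformity_nat_def
      by (rule eventually_INF1[of 1]) (use that in \<open>auto simp: eventually_principal dist_nat_def split: if_splits\<close>)
    then show ?thesis by (simp add: open_discrete)
  qed
qed (auto simp: dist_nat_def uniformity_nat_def)

end

instance nat :: complete_space
proof
  fix X :: "nat \<Rightarrow> nat"
  assume "Cauchy X"
  then obtain N where N: "\<forall>m\<ge>N. \<forall>n\<ge>N. dist (X m) (X n) < 1"
    unfolding Cauchy_def using zero_less_one[where 'a=real] by blast
  have "X n = X N" if "n \<ge> N" for n
    using N[rule_format, of n N] that by (auto simp: dist_nat_def split: if_splits)
  then have "\<forall>\<^sub>F n in sequentially. X n = X N"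
    by (rule eventually_sequentiallyI)
  then show "convergent X"
    by (intro convergentI tendsto_eventually)
qed

instance nat :: polish_space ..

text \<open>Codes will be taken in \<open>nat \<times> (nat \<Rightarrow> nat)\<close> and in
  \<open>'a \<times> (nat \<Rightarrow> nat)\<close>.\<close>

instance prod :: (polish_space, polish_space) polish_space ..

definition cyl :: "nat \<Rightarrow> (nat \<Rightarrow> nat) \<Rightarrow> (nat \<Rightarrow> nat) set" where
  "cyl n z = {z'. \<forall>l<n. z' l = z l}"

lemma open_cyl: "open (cyl n z)"
proof -
  have "cyl n z = (\<Inter>l\<in>{..<n}. (\<lambda>z'. z' l) -` {z l})"
    by (auto simp: cyl_def)
  moreover have "open ((\<lambda>z' :: nat \<Rightarrow> nat. z' l) -` {z l})" for l
    by (intro open_vimage open_discrete continuous_on_product_coordinates)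
  ultimately show ?thesis by auto
qed

lemma cyl_subset_open:
  assumes "open U" "z \<in> U"
  shows "\<exists>n. cyl n z \<subseteq> U"
proof -
  from assms obtain X where X: "z \<in> Pi\<^sub>E UNIV X"
    "finite {i. X i \<noteq> topspace (euclidean :: nat topology)}" "Pi\<^sub>E UNIV X \<subseteq> U"
    using product_topology_open_contains_basis[of "\<lambda>_. euclidean" UNIV U z]
    by (auto simp: open_fun_def)
  obtain n where n: "\<And>i. X i \<noteq> UNIV \<Longrightarrow> i < n"
    using finite_nat_set_iff_bounded[of "{i. X i \<noteq> UNIV}"] X(2) by auto
  have "cyl n z \<subseteq> Pi\<^sub>E UNIV X"
    using X(1) n by (auto simp: cyl_def PiE_iff) (metis UNIV_I)
  with X(3) show ?thesis by blast
qed

lemma continuous_if_locally_constant: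
  fixes f :: "(nat \<Rightarrow> nat) \<Rightarrow> 'b::topological_space"
  assumes "\<And>z. \<exists>n. \<forall>z'\<in>cyl n z. f z' = f z"
  shows "continuous_on UNIV f"
  unfolding continuous_on_open_vimage[OF open_UNIV]
proof (intro allI impI)
  fix B :: "'b set"
  have "\<exists>T. open T \<and> z \<in> T \<and> T \<subseteq> f -` B" if "z \<in> f -` B" for z
  proof -
    obtain n where n: "\<forall>z'\<in>cyl n z. f z' = f z" using assms by blast
    have "cyl n z \<subseteq> f -` B"
    proof
      fix z' assume "z' \<in> cyl n z"
      with n have "f z' = f z" by (rule bspec)
      with that show "z' \<in> f -` B" by simp
    qed
    moreover have "z \<in> cyl n z" by (simp add: cyl_def)
    ultimately show ?thesis using open_cyl by blast
  qed
  then show "open (f -` B \<inter> UNIV)" by (subst open_subopen) auto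
qed

section \<open>Borel sets are analytic\<close>

text \<open>A point of the Baire space lists indices into a countable dense subset of
  \<open>S\<close>. Jumps that are too long are refused, so every list converges at a fixed rate and
  the limit depends continuously on it.\<close>

lemma closed_imp_analytic:
  fixes S :: "'a::polish_space set"
  assumes "closed S"
  shows "analytic_in euclidean S"
proof (cases "S = {}")
  case False
  obtain T where T: "countable T" "T \<subseteq> S" "S \<subseteq> closure T"
    using separable by blast
  with False have "T \<noteq> {}" by auto
  define d where "d = from_nat_into T"
  have d: "range d = T"
    unfolding d_def using T(1) \<open>T \<noteq> {}\<close> by (rule range_from_nat_into[rotated])
  define x where "x v = rec_nat (d (v 0))
    (\<lambda>n y. if dist y (d (v (Suc n))) < (1/2)^n then d (v (Suc n)) else y)" for v :: "nat \<Rightarrow> nat"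
  have x0: "x v 0 = d (v 0)" for v by (simp add: x_def)
  have xS: "x v (Suc n) = (if dist (x v n) (d (v (Suc n))) < (1/2)^n then d (v (Suc n)) else x v n)"
    for v n by (simp add: x_def)
  have x_in: "x v n \<in> S" for v n
    by (induction n) (use T(2) d in \<open>auto simp: x0 xS\<close>)
  have step: "dist (x v n) (x v (Suc n)) \<le> (1/2)^n" for v n
    by (simp add: xS)
  have far: "dist (x v n) (x v (n + k)) \<le> 2 * (1/2)^n - 2 * (1/2)^(n+k)" for v n k
  proof (induction k)
    case (Suc k)
    have "dist (x v n) (x v (n + Suc k)) \<le> dist (x v n) (x v (n + k)) + dist (x v (n + k)) (x v (Suc (n + k)))"
      by (simp add: dist_triangle)
    also have "\<dots> \<le> 2 * (1/2)^n - 2 * (1/2)^(n+k) + (1/2)^(n+k)"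
      using Suc step[of v "n + k"] by linarith
    finally show ?case by simp
  qed simp
  have far': "dist (x v n) (x v m) \<le> 2 * (1/2)^n" if "n \<le> m" for v n m
  proof -
    have "dist (x v n) (x v m) \<le> 2 * (1/2)^n - 2 * (1/2)^m"
      using far[of v n "m - n"] that by simp
    also have "\<dots> \<le> 2 * (1/2)^n" by simp
    finally show ?thesis .
  qed
  have small: "\<exists>n. 2 * (1/2::real)^n < e" if "e > 0" for e
    using real_arch_pow_inv[of "e/2" "1/2"] that by (auto simp: mult.commute)
  have "Cauchy (x v)" for v
  proof (rule metric_CauchyI)
    fix e :: real assume "e > 0"
    then obtain N where N: "2 * (1/2::real)^N < e/2" using small[of "e/2"] by auto
    have "dist (x v m) (x v n) < e" if "m \<ge> N" "n \<ge> N" for m n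
      using dist_triangle_half_r[of "x v N" "x v m" e "x v n"] far'[OF that(1), of v] far'[OF that(2), of v] N
      by auto
    then show "\<exists>N. \<forall>m\<ge>N. \<forall>n\<ge>N. dist (x v m) (x v n) < e" by blast
  qed
  then have "\<exists>l. x v \<longlonglongrightarrow> l" for v
    by (simp add: Cauchy_convergent_iff convergent_def)
  then obtain L where L: "\<And>v. x v \<longlonglongrightarrow> L v" by metis
  have near: "dist (x v n) (L v) \<le> 2 * (1/2)^n" for v n
    using Lim_bounded[OF tendsto_dist[OF tendsto_const L[of v]], of n "x v n" "2 * (1/2)^n"] far'[of n _ v]
    by blast
  have x_cong: "x v n = x v' n" if "\<And>l. l \<le> n \<Longrightarrow> v l = v' l" for v v' n
    using that by (induction n) (auto simp: x0 xS)
  have cont_x: "continuous_on UNIV (\<lambda>v. x v n)" for n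
    by (rule continuous_if_locally_constant, rule exI[of _ "Suc n"])
      (auto simp: cyl_def intro: x_cong)
  have "continuous_on UNIV L"
  proof (rule uniform_limit_theorem)
    show "\<forall>\<^sub>F n in sequentially. continuous_on UNIV (\<lambda>v. x v n)"
      using cont_x by simp
    show "uniform_limit UNIV (\<lambda>n v. x v n) L sequentially"
    proof (rule uniform_limitI)
      fix e :: real assume "e > 0"
      then obtain N where N: "2 * (1/2::real)^N < e" using small by blast
      have "dist (x v n) (L v) < e" if "n \<ge> N" for n v
      proof -
        have "dist (x v n) (L v) \<le> 2 * (1/2)^n" by (rule near)
        also have "\<dots> \<le> 2 * (1/2)^N"
          using power_decreasing[OF that, of "1/2::real"] by simp
        finally show ?thesis using N by simp
      qed
      then show "\<forall>\<^sub>F n in sequentially. \<forall>v\<in>UNIV. dist (x v n) (L v) < e"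
        by (auto simp: eventually_sequentially)
    qed
  qed simp
  moreover have "range L = S"
  proof
    show "range L \<subseteq> S"
      using closed_sequentially[OF assms] x_in L by blast
    show "S \<subseteq> range L"
    proof
      fix s assume "s \<in> S"
      then have "s \<in> closure (range d)" using T(3) d by auto
      then have "\<exists>m. dist (d m) s < e" if "e > 0" for e
        using that by (auto simp: closure_approachable)
      \<comment> \<open>The margin \<open>(1/2)^(n+2)\<close> keeps consecutive listed points closer
        than \<open>(1/2)^n\<close>, so no jump is refused and the approximation runs through the
        listed points.\<close>
      from this[of "(1/2)^(n+2)" for n] have "\<exists>m. dist (d m) s < (1/2)^(n+2)" for n
        by (simp del: power_add power_Suc power_add_numeral power_add_numeral2)
      then obtain v where v: "\<And>n. dist (d (v n)) s < (1/2)^(n+2)" by metis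
      have xv: "x v n = d (v n)" for n
      proof (induction n)
        case (Suc n)
        have "dist (d (v n)) (d (v (Suc n))) < (1/2)^(n+2) + (1/2)^(Suc n+2)"
          using dist_triangle2[of "d (v n)" "d (v (Suc n))" s] v[of n] v[of "Suc n"] by linarith
        also have "\<dots> \<le> (1/2)^n" by simp
        finally show ?case by (simp add: xS Suc)
      qed (simp add: x0)
      have "x v \<longlonglongrightarrow> s"
      proof (rule metric_LIMSEQ_I)
        fix e :: real assume "e > 0"
        then obtain N where N: "2 * (1/2::real)^N < e" using small by blast
        have "dist (x v n) s < e" if "n \<ge> N" for n
        proof -
          have "dist (x v n) s < (1/2)^(n+2)" using v xv by simp
          moreover have "(1/2::real)^n \<le> (1/2)^N" by (rule power_decreasing) (use that in auto)
          moreover have "(1/2::real)^(n+2) = (1/2)^n / 4" "(0::real) \<le> (1/2)^N"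
            by (simp_all add: power_add power2_eq_square)
          ultimately show ?thesis using N by linarith
        qed
        then show "\<exists>N. \<forall>n\<ge>N. dist (x v n) s < e" by blast
      qed
      then have "L v = s" using L LIMSEQ_unique by blast
      then show "s \<in> range L" by blast
    qed
  qed
  ultimately show ?thesis by (auto simp: analytic_in_def)
qed (simp add: analytic_in_def)

lemma analytic_image:
  fixes g :: "'a::polish_space \<Rightarrow> 'b::topological_space"
  assumes "closed F" "continuous_on F g"
  shows "analytic_in euclidean (g ` F)"
proof (cases "F = {}")
  case False
  then obtain f :: "(nat \<Rightarrow> nat) \<Rightarrow> 'a" where f: "continuous_on UNIV f" "range f = F"
    using closed_imp_analytic[OF assms(1)] by (auto simp: analytic_in_def)
  have "continuous_on UNIV (g \<circ> f)"
    using f assms(2) by (intro continuous_on_compose) auto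
  moreover have "range (g \<circ> f) = g ` F" using f(2) by auto
  ultimately show ?thesis unfolding analytic_in_def by auto
qed (simp add: analytic_in_def)

lemma analytic_UN:
  fixes A :: "nat \<Rightarrow> 'a::topological_space set"
  assumes "\<And>n. analytic_in euclidean (A n)"
  shows "analytic_in euclidean (\<Union>n. A n)"
proof -
  have "\<exists>f :: (nat \<Rightarrow> nat) \<Rightarrow> 'a. A n \<noteq> {} \<longrightarrow> continuous_on UNIV f \<and> range f = A n" for n
    using assms[of n] by (auto simp: analytic_in_def)
  then obtain f :: "nat \<Rightarrow> (nat \<Rightarrow> nat) \<Rightarrow> 'a" where f: "\<And>n. A n \<noteq> {} \<Longrightarrow> continuous_on UNIV (f n) \<and> range (f n) = A n"
    by metis
  \<comment> \<open>The tag \<open>n\<close> tells which map to apply; tags of empty sets are left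
    out, as the empty set is no image of the Baire space.\<close>
  define F :: "(nat \<times> (nat \<Rightarrow> nat)) set" where "F = {n. A n \<noteq> {}} \<times> UNIV"
  have "closed F"
    unfolding F_def by (intro closed_Times closed_UNIV) (simp add: closed_def open_discrete)
  moreover have "continuous_on F (\<lambda>(n, v). f n v)"
  proof -
    have F: "F = (\<Union>n\<in>{n. A n \<noteq> {}}. {n} \<times> UNIV)" by (auto simp: F_def)
    show ?thesis
      unfolding F
    proof (rule continuous_on_open_UN)
      fix n assume "n \<in> {n. A n \<noteq> {}}"
      then have "continuous_on UNIV (f n)" using f by auto
      then have "continuous_on ({n} \<times> UNIV) (f n \<circ> snd)"
        by (intro continuous_on_compose continuous_on_snd continuous_on_id) (auto intro: continuous_on_subset)
      then show "continuous_on ({n} \<times> UNIV) (\<lambda>(n, v). f n v)"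
        by (rule continuous_on_eq) auto
    qed (intro open_Times open_discrete open_UNIV)
  qed
  ultimately have "analytic_in euclidean ((\<lambda>(n, v). f n v) ` F)"
    by (rule analytic_image)
  also have "(\<lambda>(n, v). f n v) ` F = (\<Union>n. A n)"
  proof -
    have "(\<lambda>(n, v). f n v) ` F = (\<Union>n\<in>{n. A n \<noteq> {}}. range (f n))"
      by (auto simp: F_def)
    also have "\<dots> = (\<Union>n\<in>{n. A n \<noteq> {}}. A n)" using f by (intro SUP_cong) auto
    finally show ?thesis by blast
  qed
  finally show ?thesis .
qed

text \<open>A code for a point of the intersection is a sequence of codes, one for each
  \<open>A n\<close>, that all give the same point; in a Hausdorff space this is a closed
  condition.\<close>

lemma analytic_INT:
  fixes A :: "nat \<Rightarrow> 'a::t2_space set"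
  assumes "\<And>n. analytic_in euclidean (A n)"
  shows "analytic_in euclidean (\<Inter>n. A n)"
proof (cases "\<exists>n. A n = {}")
  case True
  then have "(\<Inter>n. A n) = {}" by blast
  then show ?thesis by (simp add: analytic_in_def)
next
  case False
  then have "\<exists>f :: (nat \<Rightarrow> nat) \<Rightarrow> 'a. continuous_on UNIV f \<and> range f = A n" for n
    using assms[of n] by (auto simp: analytic_in_def)
  then obtain f :: "nat \<Rightarrow> (nat \<Rightarrow> nat) \<Rightarrow> 'a" where f: "\<And>n. continuous_on UNIV (f n)" "\<And>n. range (f n) = A n"
    by metis
  have cont: "continuous_on UNIV (\<lambda>w. f n (w n))" for n
    by (intro continuous_on_compose2[OF f(1)[of n]] continuous_on_product_coordinates) auto
  define F :: "(nat \<Rightarrow> nat \<Rightarrow> nat) set" where "F = {w. \<forall>n. f n (w n) = f 0 (w 0)}"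
  have "closed F"
    unfolding F_def by (intro closed_Collect_all closed_Collect_eq cont)
  then have "analytic_in euclidean ((\<lambda>w. f 0 (w 0)) ` F)"
    by (rule analytic_image) (rule continuous_on_subset[OF cont], simp)
  also have "(\<lambda>w. f 0 (w 0)) ` F = (\<Inter>n. A n)"
  proof
    show "(\<lambda>w. f 0 (w 0)) ` F \<subseteq> (\<Inter>n. A n)"
    proof clarify
      fix w n assume "w \<in> F"
      then have "f n (w n) = f 0 (w 0)" unfolding F_def by blast
      then show "f 0 (w 0) \<in> A n" using f(2)[of n] by (metis rangeI)
    qed
    show "(\<Inter>n. A n) \<subseteq> (\<lambda>w. f 0 (w 0)) ` F"
    proof
      fix x assume "x \<in> (\<Inter>n. A n)"
      then have "x \<in> range (f n)" for n using f(2)[of n] by auto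
      then have "\<exists>w. x = f n w" for n by blast
      then obtain w where w: "\<And>n. x = f n (w n)" by metis
      have "w \<in> F" unfolding F_def by (simp flip: w)
      with w show "x \<in> (\<lambda>w. f 0 (w 0)) ` F" by blast
    qed
  qed
  finally show ?thesis .
qed

text \<open>Complements of analytic sets need not be analytic, so the induction carries
  \<open>A\<close> and \<open>- A\<close> together; its base case uses that open sets are
  F-sigma.\<close>

lemma borel_imp_analytic:
  fixes A :: "'a::polish_space set"
  assumes "A \<in> sets borel"
  shows "analytic_in euclidean A"
proof -
  have "A \<in> sigma_sets UNIV {S. open S}"
    using assms by (simp add: borel_def)
  then have "analytic_in euclidean A \<and> analytic_in euclidean (- A)"
  proof induction
    case (Basic S)
    then have "open S" by simp
    then have "fsigma_in euclidean S"
      by (intro open_imp_fsigma_in) (auto simp: metrizable_space_euclidean)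
    then obtain C where "\<forall>n::nat. closed (C n)" "\<Union>(range C) = S"
      by (auto simp: fsigma_in_ascending)
    with \<open>open S\<close> show ?case
      using analytic_UN[of C] by (auto intro: closed_imp_analytic)
  next
    case Empty
    show ?case by (simp add: closed_imp_analytic)
  next
    case (Compl a)
    moreover have "UNIV - a = - a" "- (UNIV - a) = a" by auto
    ultimately show ?case by (simp only: conj_commute)
  next
    case (Union a)
    have "analytic_in euclidean (\<Union>i. a i)"
      by (rule analytic_UN) (use Union in blast)
    moreover have "analytic_in euclidean (\<Inter>i. - a i)"
      by (rule analytic_INT) (use Union in blast)
    ultimately show ?case by (simp only: Compl_UN simp_thms)
  qed
  then show ?thesis by blast
qed

section \<open>The Baire property\<close>

definition meager :: "'a::topological_space set \<Rightarrow> bool" where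
  "meager M \<longleftrightarrow> (\<exists>\<N>. countable \<N> \<and> (\<forall>N\<in>\<N>. closed N \<and> interior N = {}) \<and> M \<subseteq> \<Union>\<N>)"

lemma meager_subset: "meager M \<Longrightarrow> M' \<subseteq> M \<Longrightarrow> meager M'"
  unfolding meager_def by (meson subset_trans)

lemma meager_empty: "meager {}"
  unfolding meager_def by (rule exI[of _ "{}"]) simp

lemma meager_UN:
  assumes "countable I" "\<And>i. i \<in> I \<Longrightarrow> meager (M i)"
  shows "meager (\<Union>i\<in>I. M i)"
proof -
  have "\<forall>i\<in>I. \<exists>\<N>. countable \<N> \<and> (\<forall>N\<in>\<N>. closed N \<and> interior N = {}) \<and> M i \<subseteq> \<Union>\<N>"
    using assms(2) by (auto simp: meager_def)
  then obtain \<N> where \<N>: "\<forall>i\<in>I. countable (\<N> i) \<and> (\<forall>N\<in>\<N> i. closed N \<and> interior N = {}) \<and> M i \<subseteq> \<Union>(\<N> i)"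
    by (rule bchoice[THEN exE])
  have "countable (\<Union>i\<in>I. \<N> i)"
    using assms(1) \<N> by (intro countable_UN) (simp_all only: Ball_def)
  moreover have "\<forall>N\<in>(\<Union>i\<in>I. \<N> i). closed N \<and> interior N = {}"
    using \<N> by (simp only: Ball_def UN_iff Bex_def) blast
  moreover have "(\<Union>i\<in>I. M i) \<subseteq> \<Union>(\<Union>i\<in>I. \<N> i)"
  proof (rule UN_least)
    fix i assume "i \<in> I"
    then have "M i \<subseteq> \<Union>(\<N> i)" using \<N> by (simp only: Ball_def)
    also have "\<dots> \<subseteq> \<Union>(\<Union>i\<in>I. \<N> i)" using \<open>i \<in> I\<close> by blast
    finally show "M i \<subseteq> \<Union>(\<Union>i\<in>I. \<N> i)" .
  qed
  ultimately show ?thesis unfolding meager_def by blast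
qed

lemma meager_Un: "meager M \<Longrightarrow> meager M' \<Longrightarrow> meager (M \<union> M')"
  using meager_UN[of "{M, M'}" id] by auto

lemma meager_closed_minus_interior:
  assumes "closed C"
  shows "meager (C - interior C)"
proof -
  have "interior (C - interior C) = {}"
    using interior_mono[of "C - interior C" C] interior_subset[of "C - interior C"] by blast
  moreover have "closed (C - interior C)"
    using assms by (intro closed_Diff open_interior)
  ultimately show ?thesis
    unfolding meager_def by (intro exI[of _ "{C - interior C}"]) simp
qed

lemma borel_imp_baire_property:
  assumes "A \<in> sets borel"
  shows "\<exists>U. open U \<and> meager ((U - A) \<union> (A - U))"
proof -
  have "A \<in> sigma_sets UNIV {S. open S}"
    using assms by (simp add: borel_def)
  then show ?thesis
  proof induction
    case (Basic S)
    then show ?case using meager_empty by (intro exI[of _ S]) simp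
  next
    case Empty
    then show ?case using meager_empty by (intro exI[of _ "{}"]) simp
  next
    case (Compl a)
    then obtain U where U: "open U" "meager ((U - a) \<union> (a - U))" by blast
    \<comment> \<open>The closed set \<open>- U\<close> exceeds its interior by a nowhere dense set
      only.\<close>
    define V where "V = interior (- U)"
    have "V \<subseteq> - U" by (simp add: V_def interior_subset)
    have "meager (((U - a) \<union> (a - U)) \<union> (- U - V))"
      unfolding V_def by (intro meager_Un U meager_closed_minus_interior) (simp add: U closed_Compl)
    then have "meager ((V - (UNIV - a)) \<union> ((UNIV - a) - V))"
      by (rule meager_subset) (use \<open>V \<subseteq> - U\<close> in blast)
    then show ?case unfolding V_def by blast
  next
    case (Union a)
    then have "\<exists>U. open U \<and> meager ((U - a i) \<union> (a i - U))" for i :: nat by blast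
    then obtain U where U: "\<And>i. open (U i)" "\<And>i. meager ((U i - a i) \<union> (a i - U i))" by metis
    have "meager (\<Union>i. (U i - a i) \<union> (a i - U i))"
      by (intro meager_UN U) simp
    then have "meager ((\<Union>(range U) - \<Union>(range a)) \<union> (\<Union>(range a) - \<Union>(range U)))"
      by (rule meager_subset) blast
    moreover have "open (\<Union>(range U))" using U(1) by blast
    ultimately show ?case by blast
  qed
qed

lemma open_not_meager:
  fixes U :: "'a::polish_space set"
  assumes "open U" "U \<noteq> {}"
  shows "\<not> meager U"
proof
  assume "meager U"
  then obtain \<N> where \<N>: "countable \<N>" "\<forall>N\<in>\<N>. closed N \<and> interior N = {}" "U \<subseteq> \<Union>\<N>"
    unfolding meager_def by blast
  have "completely_metrizable_space (euclidean :: 'a topology)"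
    by (rule completely_metrizable_space_euclidean)
  then have "euclidean interior_of \<Union>\<N> = {}"
    using \<N> by (intro Baire_category_alt) auto
  with assms \<N>(3) show False
    using interior_maximal[OF \<N>(3) assms(1)] by simp
qed

section \<open>Fusion\<close>

lemma tendsto_baire:
  fixes X :: "nat \<Rightarrow> nat \<Rightarrow> nat"
  assumes "\<And>r. \<forall>\<^sub>F n in sequentially. X n \<in> cyl r x"
  shows "X \<longlonglongrightarrow> x"
proof (rule topological_tendstoI)
  fix S assume "open S" "x \<in> S"
  then obtain r where "cyl r x \<subseteq> S" using cyl_subset_open by blast
  then show "\<forall>\<^sub>F n in sequentially. X n \<in> S"
    using assms[of r] by (auto elim: eventually_mono)
qed

text \<open>This will let all variants of a node at entry \<open>n\<close> be generic at the same
  time.\<close>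

lemma meager_vimage_fun_upd:
  fixes M :: "(nat \<Rightarrow> nat) set"
  assumes "meager M"
  shows "meager {z. z(n := i) \<in> M}"
proof -
  obtain \<N> where \<N>: "countable \<N>" "\<forall>N\<in>\<N>. closed N \<and> interior N = {}" "M \<subseteq> \<Union>\<N>"
    using assms unfolding meager_def by blast
  have cont: "continuous_on UNIV (\<lambda>z :: nat \<Rightarrow> nat. z(n := i))"
  proof (rule continuous_on_coordinatewise_then_product)
    fix l
    show "continuous_on UNIV (\<lambda>z :: nat \<Rightarrow> nat. (z(n := i)) l)"
      by (cases "l = n") (simp_all add: continuous_on_product_coordinates)
  qed
  have "closed ((\<lambda>z. z(n := i)) -` N) \<and> interior ((\<lambda>z. z(n := i)) -` N) = {}" if "N \<in> \<N>" for N
  proof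
    show "closed ((\<lambda>z. z(n := i)) -` N)"
      using cont \<N>(2) that by (intro closed_vimage) auto
    have False if x: "x \<in> interior ((\<lambda>z. z(n := i)) -` N)" for x
    proof -
      obtain r where r: "cyl r x \<subseteq> interior ((\<lambda>z. z(n := i)) -` N)"
        using cyl_subset_open[OF open_interior x] by blast
      \<comment> \<open>The length \<open>Suc n\<close> pins entry \<open>n\<close> to
        \<open>i\<close>, which makes \<open>z\<close> the image of
        \<open>z(n := x n)\<close>.\<close>
      have "cyl (max r (Suc n)) (x(n := i)) \<subseteq> N"
      proof
        fix z assume z: "z \<in> cyl (max r (Suc n)) (x(n := i))"
        then have "z(n := x n) \<in> cyl r x" by (auto simp: cyl_def)
        then have "z(n := x n) \<in> (\<lambda>z. z(n := i)) -` N" using r interior_subset by blast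
        moreover have "z n = i" using z by (simp add: cyl_def)
        ultimately show "z \<in> N" by auto
      qed
      then have "cyl (max r (Suc n)) (x(n := i)) \<subseteq> interior N"
        by (rule interior_maximal) (rule open_cyl)
      moreover have "x(n := i) \<in> cyl (max r (Suc n)) (x(n := i))" by (simp add: cyl_def)
      ultimately show False using \<N>(2) \<open>N \<in> \<N>\<close> by blast
    qed
    then show "interior ((\<lambda>z. z(n := i)) -` N) = {}" by blast
  qed
  then have "\<forall>N\<in>(\<lambda>N. (\<lambda>z. z(n := i)) -` N) ` \<N>. closed N \<and> interior N = {}" by blast
  moreover have "{z. z(n := i) \<in> M} \<subseteq> \<Union>((\<lambda>N. (\<lambda>z. z(n := i)) -` N) ` \<N>)"
    using \<N>(3) by blast
  ultimately show ?thesis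
    using \<N>(1) unfolding meager_def by (meson countable_image)
qed

text \<open>Request \<open>n\<close> is a hypergraph together with a finite sequence; every pair is requested
  infinitely often.\<close>

definition req :: "nat \<Rightarrow> nat \<times> nat list" where
  "req n = from_nat (snd (prod_decode n))"

definition req_graph :: "nat \<Rightarrow> nat" where
  "req_graph n = fst (req n)"

definition req_node :: "nat \<Rightarrow> nat \<Rightarrow> nat" where
  "req_node n l = (if l < length (snd (req n)) then snd (req n) ! l else 0)"

lemma ex_req:
  "\<exists>n\<ge>r. req_graph n = m \<and> req_node n \<in> cyl r s"
proof -
  \<comment> \<open>The first component of the pair is ignored by \<open>req\<close> and serves to
    make \<open>n\<close> at least \<open>r\<close>.\<close>
  define n where "n = prod_encode (r, to_nat (m, map s [0..<r]))"
  have "req n = (m, map s [0..<r])" by (simp add: req_def n_def)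
  then have "req_graph n = m" "req_node n \<in> cyl r s"
    by (simp_all add: req_graph_def req_node_def cyl_def)
  moreover have "r \<le> n" unfolding n_def by (rule le_prod_encode_1)
  ultimately show ?thesis by blast
qed

text \<open>The hypergraph number \<open>m\<close> consists of the edges \<open>\<xi> m w 0, \<dots>, \<xi> m w (\<kappa> m w - 1)\<close>.\<close>

locale edge_family =
  fixes \<kappa> :: "nat \<Rightarrow> (nat \<Rightarrow> nat) \<Rightarrow> nat"
    and \<xi> :: "nat \<Rightarrow> (nat \<Rightarrow> nat) \<Rightarrow> nat \<Rightarrow> 'a::t2_space"
    and \<psi> :: "(nat \<Rightarrow> nat) \<Rightarrow> 'a"
    and T :: "nat \<Rightarrow> (nat \<Rightarrow> nat) set"
    and V :: "(nat \<Rightarrow> nat) set"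
  assumes \<kappa>_pos: "\<kappa> m w > 0"
    and closed_\<kappa>: "closed {w. \<kappa> m w = k}"
    and cont_\<xi>: "continuous_on {w. i < \<kappa> m w} (\<lambda>w. \<xi> m w i)"
    and cont_\<psi>: "continuous_on UNIV \<psi>"
    and closed_T: "closed (T n)"
    and ex_T: "finite F \<Longrightarrow> F \<subseteq> V \<Longrightarrow> \<exists>y\<ge>n. F \<subseteq> T y"
begin

section \<open>Anticliques in terms of codes, and the sigma-ideal they generate\<close>

definition free :: "nat \<Rightarrow> 'a set \<Rightarrow> bool" where
  "free m A \<longleftrightarrow> (\<nexists>w. \<forall>i<\<kappa> m w. \<xi> m w i \<in> A)"

text \<open>The generators are arbitrary anticliques, Borel or not, as in the small anticlique
  property.\<close>

definition small :: "'a set \<Rightarrow> bool" where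
  "small N \<longleftrightarrow> (\<exists>\<C>. countable \<C> \<and> (\<forall>A\<in>\<C>. \<exists>m. free m A) \<and> N \<subseteq> \<Union>\<C>)"

lemma small_UN:
  assumes "countable I" "\<And>i. i \<in> I \<Longrightarrow> small (N i)"
  shows "small (\<Union>i\<in>I. N i)"
proof -
  have "\<forall>i\<in>I. \<exists>\<C>. countable \<C> \<and> (\<forall>A\<in>\<C>. \<exists>m. free m A) \<and> N i \<subseteq> \<Union>\<C>"
    using assms(2) by (simp add: small_def)
  then obtain \<C> where \<C>: "\<forall>i\<in>I. countable (\<C> i) \<and> (\<forall>A\<in>\<C> i. \<exists>m. free m A) \<and> N i \<subseteq> \<Union>(\<C> i)"
    by (rule bchoice[THEN exE])
  have "countable (\<Union>i\<in>I. \<C> i)"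
    using assms(1) \<C> by (intro countable_UN) (simp_all only: Ball_def)
  moreover have "\<forall>A\<in>(\<Union>i\<in>I. \<C> i). \<exists>m. free m A"
    using \<C> by (simp only: Ball_def UN_iff Bex_def) blast
  moreover have "(\<Union>i\<in>I. N i) \<subseteq> \<Union>(\<Union>i\<in>I. \<C> i)"
  proof (rule UN_least)
    fix i assume "i \<in> I"
    then have "N i \<subseteq> \<Union>(\<C> i)" using \<C> by (simp only: Ball_def)
    also have "\<dots> \<subseteq> \<Union>(\<Union>i\<in>I. \<C> i)" using \<open>i \<in> I\<close> by blast
    finally show "N i \<subseteq> \<Union>(\<Union>i\<in>I. \<C> i)" .
  qed
  ultimately show ?thesis unfolding small_def by blast
qed

lemma small_Un: "small M \<Longrightarrow> small N \<Longrightarrow> small (M \<union> N)"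
  using small_UN[of "{M, N}" id] by auto

lemma small_free: "free m A \<Longrightarrow> small A"
  unfolding small_def by (intro exI[of _ "{A}"]) auto

lemma small_subset: "small N \<Longrightarrow> M \<subseteq> N \<Longrightarrow> small M"
  unfolding small_def by (meson subset_trans)

text \<open>A configuration \<open>e\<close> of level \<open>n\<close> assigns the vertex \<open>\<psi> (e 0 z)\<close> to the node \<open>z\<close>, of which only
  the first \<open>n\<close> entries matter, and for \<open>j < n\<close> the code \<open>e (Suc j) z\<close> of an edge in the
  hypergraph requested at stage \<open>j\<close> to the nodes that differ from \<open>z\<close> at most in entry \<open>j\<close>.\<close>

type_synonym config = "nat \<Rightarrow> (nat \<Rightarrow> nat) \<Rightarrow> nat \<Rightarrow> nat"

text \<open>Positivity for families of configurations: a family is negligible when one small set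
  meets the vertices of each member, at whatever node.\<close>

definition large :: "config set \<Rightarrow> bool" where
  "large \<E> \<longleftrightarrow> (\<nexists>N. small N \<and> (\<forall>e\<in>\<E>. \<exists>z. \<psi> (e 0 z) \<in> N))"

lemma large_mono: "large \<E> \<Longrightarrow> \<E> \<subseteq> \<F> \<Longrightarrow> large \<F>"
  unfolding large_def by (meson subsetD)

text \<open>Witnesses of negligibility unite. Every parameter in the fusion step is fixed by this
  pigeonhole principle.\<close>

lemma large_UN:
  assumes "countable I" "large (\<Union>i\<in>I. \<E> i)"
  shows "\<exists>i\<in>I. large (\<E> i)"
proof (rule ccontr)
  assume "\<not> ?thesis"
  then have "\<forall>i\<in>I. \<exists>N. small N \<and> (\<forall>e\<in>\<E> i. \<exists>z. \<psi> (e 0 z) \<in> N)"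
    by (simp add: large_def)
  then obtain N where N: "\<forall>i\<in>I. small (N i) \<and> (\<forall>e\<in>\<E> i. \<exists>z. \<psi> (e 0 z) \<in> N i)"
    by (rule bchoice[THEN exE])
  have "small (\<Union>i\<in>I. N i)"
    using assms(1) N by (intro small_UN) (simp_all only: Ball_def)
  moreover have "\<exists>z. \<psi> (e 0 z) \<in> (\<Union>i\<in>I. N i)" if "e \<in> (\<Union>i\<in>I. \<E> i)" for e
    using that N by (simp only: Ball_def UN_iff Bex_def) blast
  ultimately show False using assms(2) unfolding large_def by blast
qed

lemma large_nonempty: "large \<E> \<Longrightarrow> \<E> \<noteq> {}"
  unfolding large_def small_def by blast

text \<open>Entry \<open>n\<close> of the node selects one of \<open>k\<close> copies, with entries
  from \<open>k\<close> on falling back to copy 0; the new component \<open>Suc n\<close> is the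
  code \<open>w\<close> of the edge that links the copies.\<close>

definition glue :: "nat \<Rightarrow> nat \<Rightarrow> (nat \<Rightarrow> config) \<Rightarrow> (nat \<Rightarrow> nat) \<Rightarrow> config" where
  "glue n k c w = (\<lambda>j z. if j \<le> n then c (if z n < k then z n else 0) j z else w)"

text \<open>The finite set \<open>Z\<close> of representative nodes keeps the vertices of each
  member finite in number, as \<open>ex_T\<close> demands; the last clause freezes the first
  \<open>n\<close> values of every code and so makes the fusion converge.\<close>

definition inv_at :: "nat \<Rightarrow> config set \<Rightarrow> bool" where
  "inv_at n \<E> \<longleftrightarrow> large \<E> \<and> (\<forall>e\<in>\<E>. \<forall>z. e 0 z \<in> V) \<and>
     (\<forall>e\<in>\<E>. \<forall>j\<le>n. \<forall>z. \<forall>z'\<in>cyl n z. e j z' = e j z) \<and>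
     (\<exists>Z. finite Z \<and> (\<forall>z. \<exists>z'\<in>Z. \<forall>e\<in>\<E>. \<forall>j\<le>n. e j z = e j z')) \<and>
     (\<forall>e\<in>\<E>. \<forall>e'\<in>\<E>. \<forall>j\<le>n. \<forall>z. e' j z \<in> cyl n (e j z))"

lemma inv_atD:
  assumes "inv_at n \<E>"
  shows "large \<E>" "e \<in> \<E> \<Longrightarrow> e 0 z \<in> V"
    "e \<in> \<E> \<Longrightarrow> j \<le> n \<Longrightarrow> z' \<in> cyl n z \<Longrightarrow> e j z' = e j z"
    "e \<in> \<E> \<Longrightarrow> e' \<in> \<E> \<Longrightarrow> j \<le> n \<Longrightarrow> e' j z \<in> cyl n (e j z)"
  using assms by (simp_all only: inv_at_def Ball_def)

text \<open>Here \<open>k\<close> is the length of the edges glued along, and \<open>y\<close> is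
  the next element of the infinite set to be built.\<close>

definition step :: "nat \<Rightarrow> config set \<Rightarrow> nat \<Rightarrow> nat \<Rightarrow> config set \<Rightarrow> bool" where
  "step n \<E> k y \<E>' \<longleftrightarrow> k > 0 \<and> y \<ge> n \<and> (\<forall>e'\<in>\<E>'. (\<forall>z. e' 0 z \<in> T y) \<and>
     (\<exists>c w. (\<forall>i. c i \<in> \<E>) \<and> \<kappa> (req_graph n) w = k \<and>
       (\<forall>i<k. \<xi> (req_graph n) w i = \<psi> (c i 0 (req_node n))) \<and> e' = glue n k c w))"

lemma stepD:
  assumes "step n \<E> k y \<E>'"
  shows "n \<le> y" "e \<in> \<E>' \<Longrightarrow> e 0 z \<in> T y"
    "e \<in> \<E>' \<Longrightarrow> \<exists>c w. (\<forall>i. c i \<in> \<E>) \<and> \<kappa> (req_graph n) w = k \<and>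
       (\<forall>i<k. \<xi> (req_graph n) w i = \<psi> (c i 0 (req_node n))) \<and> e = glue n k c w"
  using assms by (simp_all only: step_def Ball_def)

text \<open>Gluing along all edges formed at the requested node keeps the family large. Countably
  many values of \<open>k\<close>, of \<open>y\<close> and of initial segments of codes are then cut
  down to one each by \<open>large_UN\<close>. As edges are finite, a glued configuration still has
  finitely many vertices.\<close>

lemma ex_step:
  assumes "inv_at n \<E>"
  shows "\<exists>\<E>'. inv_at (Suc n) \<E>' \<and> (\<exists>k y. step n \<E> k y \<E>')"
proof -
  note large = inv_atD(1)[OF assms] and in_V = inv_atD(2)[OF assms] and loc = inv_atD(3)[OF assms]
  obtain Z where Z: "finite Z" "\<And>z. \<exists>z'\<in>Z. \<forall>e\<in>\<E>. \<forall>j\<le>n. e j z = e j z'"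
    using assms unfolding inv_at_def by blast
  define m where "m = req_graph n"
  define s where "s = req_node n"
  define E1 where "E1 k = {e'. \<exists>c w. (\<forall>i. c i \<in> \<E>) \<and> \<kappa> m w = k \<and>
    (\<forall>i<k. \<xi> m w i = \<psi> (c i 0 s)) \<and> e' = glue n k c w}" for k
  have "large (\<Union>k. E1 k)"
    unfolding large_def
  proof
    assume "\<exists>N. small N \<and> (\<forall>e\<in>(\<Union>k. E1 k). \<exists>z. \<psi> (e 0 z) \<in> N)"
    then obtain N where N: "small N" "\<And>k e. e \<in> E1 k \<Longrightarrow> \<exists>z. \<psi> (e 0 z) \<in> N" by blast
    \<comment> \<open>If \<open>N\<close> met every glued configuration, the requested vertices of
      the members avoiding \<open>N\<close> would contain no edge, because gluing along such an edge
      gives a configuration that avoids \<open>N\<close>. Then the small set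
      \<open>N \<union> A\<close> would meet every member.\<close>
    define A where "A = {\<psi> (e 0 s) | e. e \<in> \<E> \<and> (\<forall>z. \<psi> (e 0 z) \<notin> N)}"
    have "free m A"
      unfolding free_def
    proof
      assume "\<exists>w. \<forall>i<\<kappa> m w. \<xi> m w i \<in> A"
      then obtain w where w: "\<forall>i<\<kappa> m w. \<xi> m w i \<in> A" by blast
      have "\<exists>e. \<xi> m w i = \<psi> (e 0 s) \<and> e \<in> \<E> \<and> (\<forall>z. \<psi> (e 0 z) \<notin> N)" if "i < \<kappa> m w" for i
        using w that unfolding A_def by blast
      then obtain c where c: "\<And>i. i < \<kappa> m w \<Longrightarrow> \<xi> m w i = \<psi> (c i 0 s)"
        "\<And>i. i < \<kappa> m w \<Longrightarrow> c i \<in> \<E>" "\<And>i z. i < \<kappa> m w \<Longrightarrow> \<psi> (c i 0 z) \<notin> N"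
        by metis
      \<comment> \<open>Indices beyond the edge repeat \<open>c 0\<close>, so that every
        \<open>d i\<close> is a member; \<open>\<kappa>_pos\<close> supplies the index 0.\<close>
      define d where "d i = c (if i < \<kappa> m w then i else 0)" for i
      have "glue n (\<kappa> m w) d w \<in> E1 (\<kappa> m w)"
        unfolding E1_def using c \<kappa>_pos[of m w]
        by (intro CollectI exI[of _ d] exI[of _ w]) (simp add: d_def)
      then obtain z where "\<psi> (glue n (\<kappa> m w) d w 0 z) \<in> N" using N(2) by blast
      moreover have "\<psi> (glue n (\<kappa> m w) d w 0 z) \<notin> N"
        using c(3) \<kappa>_pos[of m w] by (simp add: glue_def d_def)
      ultimately show False by contradiction
    qed
    then have "small (N \<union> A)" using N(1) small_Un small_free by blast
    moreover have "\<exists>z. \<psi> (e 0 z) \<in> N \<union> A" if "e \<in> \<E>" for e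
    proof (cases "\<exists>z. \<psi> (e 0 z) \<in> N")
      case False
      with that have "\<psi> (e 0 s) \<in> A" unfolding A_def by blast
      then show ?thesis by blast
    qed blast
    ultimately show False using large unfolding large_def by blast
  qed
  then obtain k where k: "large (E1 k)" using large_UN[of UNIV E1] by blast
  have "k > 0"
  proof -
    obtain e where "e \<in> E1 k" using large_nonempty[OF k] by blast
    then obtain w where "\<kappa> m w = k" unfolding E1_def by blast
    with \<kappa>_pos[of m w] show ?thesis by simp
  qed
  \<comment> \<open>A node acts through its old representative and its entry \<open>n\<close>, read
    as 0 if it is \<open>k\<close> or more.\<close>
  have Z': "\<exists>z'\<in>(\<lambda>(z, i). z(n := i)) ` (Z \<times> {..<k}). \<forall>e\<in>E1 k. \<forall>j\<le>Suc n. e j z = e j z'" for z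
  proof -
    define i where "i = (if z n < k then z n else 0)"
    have "i < k" using \<open>k > 0\<close> by (simp add: i_def)
    obtain z' where z': "z' \<in> Z" "\<And>e j. e \<in> \<E> \<Longrightarrow> j \<le> n \<Longrightarrow> e j z = e j z'" using Z(2)[of z] by blast
    have "e j z = e j (z'(n := i))" if "e \<in> E1 k" for e j
    proof -
      obtain c w where c: "\<And>i. c i \<in> \<E>" "e = glue n k c w"
        using \<open>e \<in> E1 k\<close> unfolding E1_def by blast
      have "c i j z = c i j (z'(n := i))" if "j \<le> n"
        using z'(2)[OF c(1) that] loc[OF c(1) that, of "z'(n := i)" z'] by (simp add: cyl_def)
      then show ?thesis using \<open>i < k\<close> by (simp add: c(2) glue_def flip: i_def)
    qed
    with z'(1) \<open>i < k\<close> show ?thesis by (intro bexI[of _ "z'(n := i)"]) auto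
  qed
  define Z' where "Z' = (\<lambda>(z, i). z(n := i)) ` (Z \<times> {..<k})"
  have "finite Z'" using Z(1) by (simp add: Z'_def)
  have E1_V: "e 0 z \<in> V" if "e \<in> E1 k" for e z
  proof -
    obtain c w where c: "\<And>i. c i \<in> \<E>" "e = glue n k c w"
      using \<open>e \<in> E1 k\<close> unfolding E1_def by blast
    show ?thesis using in_V[OF c(1)] by (simp add: c(2) glue_def)
  qed
  \<comment> \<open>A glued configuration has finitely many vertices, all in \<open>V\<close>, so
    some \<open>T y\<close> with \<open>y \<ge> n\<close> contains them. This \<open>y\<close>
    depends on the configuration; largeness selects a single one.\<close>
  define E2 where "E2 y = {e \<in> E1 k. \<forall>z. e 0 z \<in> T y}" for y
  have "E1 k \<subseteq> (\<Union>y\<in>{n..}. E2 y)"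
  proof
    fix e assume e: "e \<in> E1 k"
    have "range (e 0) \<subseteq> e 0 ` Z'"
    proof clarify
      fix z
      obtain z' where "z' \<in> Z'" "e 0 z = e 0 z'"
        using Z'[of z] e unfolding Z'_def[symmetric] by blast
      then show "e 0 z \<in> e 0 ` Z'" by (simp only: imageI)
    qed
    then have "finite (range (e 0))" using \<open>finite Z'\<close> finite_surj by blast
    moreover have "range (e 0) \<subseteq> V" using E1_V[OF e] by blast
    ultimately obtain y where "y \<ge> n" "range (e 0) \<subseteq> T y" using ex_T by blast
    with e show "e \<in> (\<Union>y\<in>{n..}. E2 y)" unfolding E2_def by blast
  qed
  then obtain y where y: "y \<ge> n" "large (E2 y)"
    using large_UN[of "{n..}" E2] large_mono[OF k] by blast
  \<comment> \<open>The record covers, at the representatives, the first \<open>Suc n\<close> values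
    of all components up to \<open>Suc n\<close>, hence of the new edge code too. There are
    countably many records, so some large subfamily shares one.\<close>
  define info where "info e = restrict
    (\<lambda>z. map (\<lambda>j. map (e j z) [0..<Suc n]) [0..<Suc (Suc n)]) Z'" for e :: config
  have "E2 y = (\<Union>a\<in>Z' \<rightarrow>\<^sub>E UNIV. {e \<in> E2 y. info e = a})"
    unfolding info_def by auto
  moreover have "countable (Z' \<rightarrow>\<^sub>E (UNIV :: nat list list set))"
    using \<open>finite Z'\<close> by (intro countable_PiE) simp_all
  ultimately obtain a where a: "large {e \<in> E2 y. info e = a}"
    using y(2) large_UN[of "Z' \<rightarrow>\<^sub>E UNIV" "\<lambda>a. {e \<in> E2 y. info e = a}"] by auto
  define \<E>' where "\<E>' = {e \<in> E2 y. info e = a}"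
  have sub: "\<E>' \<subseteq> E1 k" by (auto simp: \<E>'_def E2_def)
  have "e j z' = e j z" if "e \<in> \<E>'" "j \<le> Suc n" "z' \<in> cyl (Suc n) z" for e j z z'
  proof -
    obtain c w where c: "\<And>i. c i \<in> \<E>" "e = glue n k c w"
      using \<open>e \<in> \<E>'\<close> sub unfolding E1_def by blast
    have "z' n = z n" "z' \<in> cyl n z" using that(3) by (simp_all add: cyl_def)
    then show ?thesis using loc[OF c(1), of j z' z] by (simp add: c(2) glue_def)
  qed
  moreover have "e' j z \<in> cyl (Suc n) (e j z)"
    if e: "e \<in> \<E>'" and e': "e' \<in> \<E>'" and j: "j \<le> Suc n" for e e' j z
  proof -
    obtain z' where z': "z' \<in> Z'" "\<And>e. e \<in> \<E>' \<Longrightarrow> e j z = e j z'"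
      using Z'[of z] sub j unfolding Z'_def[symmetric] by blast
    have "info e z' = info e' z'" using e e' by (simp add: \<E>'_def)
    then have "map (\<lambda>j. map (e j z') [0..<Suc n]) [0..<Suc (Suc n)] =
      map (\<lambda>j. map (e' j z') [0..<Suc n]) [0..<Suc (Suc n)]"
      using z'(1) unfolding info_def restrict_apply by (simp only: if_True)
    then have "map (e j z') [0..<Suc n] = map (e' j z') [0..<Suc n]"
      using j by (simp only: map_eq_conv set_upt) simp
    then have "\<And>l. l < Suc n \<Longrightarrow> e j z' l = e' j z' l" by (simp only: map_eq_conv set_upt) simp
    then show ?thesis unfolding cyl_def z'(2)[OF e] z'(2)[OF e'] by simp
  qed
  moreover have "finite Z' \<and> (\<forall>z. \<exists>z'\<in>Z'. \<forall>e\<in>\<E>'. \<forall>j\<le>Suc n. e j z = e j z')"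
    using \<open>finite Z'\<close> Z' sub unfolding Z'_def[symmetric] by (meson subsetD)
  ultimately have "inv_at (Suc n) \<E>'"
    using a E1_V sub unfolding inv_at_def \<E>'_def[symmetric] by blast
  moreover have "step n \<E> k y \<E>'"
    using \<open>k > 0\<close> y(1) unfolding step_def \<E>'_def E2_def E1_def m_def s_def by blast
  ultimately show ?thesis by blast
qed

text \<open>Members of the successive families converge, since their values freeze. Closedness of
  \<open>T y\<close> and of the fibers of \<open>\<kappa>\<close>, and continuity of
  \<open>\<xi>\<close> and \<open>\<psi>\<close>, carry the properties of the stages to the
  limit.\<close>

lemma ex_fusion:
  assumes "\<not> small (\<psi> ` V)"
  shows "\<exists>Y \<phi> k. infinite Y \<and> continuous_on UNIV \<phi> \<and> (\<forall>z. \<forall>y\<in>Y. \<phi> z \<in> T y) \<and>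
    (\<forall>n. \<forall>z\<in>cyl n (req_node n). \<exists>w. \<kappa> (req_graph n) w = k n \<and>
       (\<forall>i<k n. \<xi> (req_graph n) w i = \<psi> (\<phi> (z(n := i)))))"
proof -
  \<comment> \<open>At level 0 a single point of \<open>V\<close> sits at every node.\<close>
  define E0 :: "config set" where "E0 = {e. \<exists>v\<in>V. \<forall>z. e 0 z = v}"
  have "inv_at 0 E0"
  proof -
    have "\<not> (\<forall>e\<in>E0. \<exists>z. \<psi> (e 0 z) \<in> N)" if "small N" for N
    proof -
      have "\<not> \<psi> ` V \<subseteq> N" using assms that small_subset by blast
      then obtain v where "v \<in> V" "\<psi> v \<notin> N" by blast
      then have "(\<lambda>_ _. v) \<in> E0" by (simp add: E0_def)
      with \<open>\<psi> v \<notin> N\<close> show ?thesis by (intro notI) (drule (1) bspec, simp)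
    qed
    then have "large E0"
      unfolding large_def by blast
    moreover have "\<forall>e\<in>E0. \<forall>z. e 0 z \<in> V"
      and "\<forall>e\<in>E0. \<forall>j\<le>0 :: nat. \<forall>z. \<forall>z'\<in>cyl 0 z. e j z' = e j z"
      and "\<exists>Z. finite Z \<and>
        (\<forall>z. \<exists>z'\<in>Z. \<forall>e\<in>E0. \<forall>j\<le>0 :: nat. e j z = e j z')"
      and "\<forall>e\<in>E0. \<forall>e'\<in>E0.
        \<forall>j\<le>0 :: nat. \<forall>z. e' j z \<in> cyl 0 (e j z)"
      by (auto simp: E0_def cyl_def intro!: exI[of _ "{\<lambda>_. 0}"])
    ultimately show ?thesis unfolding inv_at_def by (intro conjI)
  qed
  then have "\<exists>\<E>. inv_at 0 \<E>" by (rule exI)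
  then have "\<exists>\<E>. \<forall>n. inv_at n (\<E> n) \<and> (\<exists>k y. step n (\<E> n) k y (\<E> (Suc n)))"
    by (rule dependent_nat_choice) (rule ex_step)
  then obtain \<E> where \<E>: "\<forall>n. inv_at n (\<E> n) \<and> (\<exists>k y. step n (\<E> n) k y (\<E> (Suc n)))"
    by (rule exE)
  then have "\<forall>n. \<exists>k y. step n (\<E> n) k y (\<E> (Suc n))" by (simp only: simp_thms)
  then obtain k where "\<forall>n. \<exists>y. step n (\<E> n) (k n) y (\<E> (Suc n))"
    unfolding choice_iff by (rule exE)
  then obtain y where steps: "\<forall>n. step n (\<E> n) (k n) (y n) (\<E> (Suc n))"
    unfolding choice_iff by (rule exE)
  have inv: "inv_at n (\<E> n)" for n using \<E> by (simp only: simp_thms)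
  note loc = inv_atD(3)[OF inv] and agree = inv_atD(4)[OF inv]
  have "\<exists>e. e \<in> \<E> n" for n
    using large_nonempty[OF inv_atD(1)[OF inv]] by blast
  then obtain E where E: "\<And>n. E n \<in> \<E> n" by metis
  note y_ge = stepD(1)[OF spec[OF steps]] and in_T = stepD(2)[OF spec[OF steps]]
    and glued = stepD(3)[OF spec[OF steps]]
  \<comment> \<open>The stage \<open>max j (Suc l)\<close> is the first at which component
    \<open>j\<close> and value \<open>l\<close> are both frozen; all members of that and all later
    families agree there.\<close>
  define \<zeta> where "\<zeta> j z l = E (max j (Suc l)) j z l" for j z l
  have \<zeta>: "e j z l = \<zeta> j z l" if "max j (Suc l) \<le> n" "e \<in> \<E> n" for e n j z l
    using that
  proof (induction n arbitrary: e rule: dec_induct)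
    case base
    then show ?case using agree[OF E base(1), of j z] by (simp add: \<zeta>_def cyl_def)
  next
    case (step n)
    obtain c w where c: "\<And>i. c i \<in> \<E> n" "e = glue n (k n) c w"
      using glued[OF step(4)] by blast
    have "e j z l = c (if z n < k n then z n else 0) j z l"
      using step(1) by (simp add: c(2) glue_def)
    also have "\<dots> = \<zeta> j z l" by (rule step(3)[OF c(1)])
    finally show ?case .
  qed
  have lim: "(\<lambda>n. E n j z) \<longlonglongrightarrow> \<zeta> j z" for j z
  proof (rule tendsto_baire)
    fix r
    have "E n j z \<in> cyl r (\<zeta> j z)" if "n \<ge> max j r" for n
      using \<zeta>[OF _ E, of j _ n z] that by (auto simp: cyl_def)
    then show "\<forall>\<^sub>F n in sequentially. E n j z \<in> cyl r (\<zeta> j z)"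
      by (rule eventually_sequentiallyI)
  qed
  have cont: "continuous_on UNIV (\<zeta> 0)"
  proof (intro continuous_on_coordinatewise_then_product continuous_if_locally_constant exI ballI)
    fix l z z' assume "z' \<in> cyl (Suc l) z"
    then have "E (Suc l) 0 z' = E (Suc l) 0 z" by (intro loc[OF E]) auto
    then show "\<zeta> 0 z' l = \<zeta> 0 z l" by (simp add: \<zeta>_def)
  qed
  \<comment> \<open>Gluing reuses vertices of the previous stage, so \<open>T (y j)\<close> is never
    left again.\<close>
  have T_later: "e 0 z \<in> T (y j)" if "Suc j \<le> n" "e \<in> \<E> n" for e n j z
    using that
  proof (induction n arbitrary: e rule: dec_induct)
    case base
    then show ?case using in_T by blast
  next
    case (step n)
    obtain c w where c: "\<And>i. c i \<in> \<E> n" "e = glue n (k n) c w"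
      using glued[OF step(4)] by blast
    then show ?case using step(3)[OF c(1)] by (simp add: glue_def)
  qed
  have "\<zeta> 0 z \<in> T (y j)" for z j
  proof (rule closed_sequentially[OF closed_T])
    show "(\<lambda>n. E (n + Suc j) 0 z) \<longlonglongrightarrow> \<zeta> 0 z" by (rule LIMSEQ_ignore_initial_segment[OF lim])
    show "E (n + Suc j) 0 z \<in> T (y j)" for n by (rule T_later[OF _ E]) simp
  qed
  moreover have "infinite (range y)"
  proof -
    have "\<exists>m'\<ge>m. m' \<in> range y" for m using y_ge[of m] by blast
    then show ?thesis unfolding infinite_nat_iff_unbounded_le by blast
  qed
  moreover have "\<exists>w. \<kappa> (req_graph j) w = k j \<and> (\<forall>i<k j. \<xi> (req_graph j) w i = \<psi> (\<zeta> 0 (z(j := i))))"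
    if z: "z \<in> cyl j (req_node j)" for j z
  proof -
    \<comment> \<open>The nodes \<open>z(j := i)\<close> agree with \<open>z\<close> outside entry
      \<open>j\<close>, so a gluing at a stage after \<open>j\<close> sends them all to the same
      copy and the edge survives.\<close>
    have edge: "\<kappa> (req_graph j) (e (Suc j) z) = k j \<and>
      (\<forall>i<k j. \<xi> (req_graph j) (e (Suc j) z) i = \<psi> (e 0 (z(j := i))))"
      if "Suc j \<le> n" "e \<in> \<E> n" for n e
      using that
    proof (induction n arbitrary: e rule: dec_induct)
      case base
      obtain c w where c: "\<And>i. c i \<in> \<E> j" "\<kappa> (req_graph j) w = k j"
        "\<And>i. i < k j \<Longrightarrow> \<xi> (req_graph j) w i = \<psi> (c i 0 (req_node j))" "e = glue j (k j) c w"
        using glued[OF base] by blast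
      \<comment> \<open>At level \<open>j\<close> only the first \<open>j\<close> entries count, and
        there \<open>z\<close> agrees with the requested node.\<close>
      have "c i 0 (z(j := i)) = c i 0 (req_node j)" for i
        by (rule loc[OF c(1)]) (use z in \<open>auto simp: cyl_def\<close>)
      moreover have "e 0 (z(j := i)) = c i 0 (z(j := i))" if "i < k j" for i
        using that by (simp add: c(4) glue_def)
      moreover have w: "e (Suc j) z = w" by (simp add: c(4) glue_def)
      ultimately have "\<xi> (req_graph j) (e (Suc j) z) i = \<psi> (e 0 (z(j := i)))" if "i < k j" for i
        using c(3) that by metis
      then show ?case using c(2) w by blast
    next
      case (step n)
      obtain c w where c: "\<And>i. c i \<in> \<E> n" "e = glue n (k n) c w"
        using glued[OF step(4)] by blast
      define d where "d = c (if z n < k n then z n else 0)"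
      have "e (Suc j) z = d (Suc j) z" "\<And>i. e 0 (z(j := i)) = d 0 (z(j := i))"
        using step(1) by (simp_all add: c(2) glue_def d_def)
      moreover have "d \<in> \<E> n" unfolding d_def by (rule c(1))
      then have "\<kappa> (req_graph j) (d (Suc j) z) = k j \<and>
        (\<forall>i<k j. \<xi> (req_graph j) (d (Suc j) z) i = \<psi> (d 0 (z(j := i))))"
        by (rule step(3))
      ultimately show ?case by (simp only:) blast
    qed
    define W where "W n = E (n + Suc j) (Suc j) z" for n
    have W: "W \<longlonglongrightarrow> \<zeta> (Suc j) z"
      unfolding W_def by (rule LIMSEQ_ignore_initial_segment[OF lim])
    have \<kappa>W: "\<kappa> (req_graph j) (W n) = k j" for n
      unfolding W_def using edge[OF _ E] by simp
    \<comment> \<open>This puts the limit code into the set on which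
      \<open>\<lambda>w. \<xi> (req_graph j) w i\<close> is continuous.\<close>
    have \<kappa>\<zeta>: "\<kappa> (req_graph j) (\<zeta> (Suc j) z) = k j"
      using closed_sequentially[OF closed_\<kappa> _ W, of "req_graph j" "k j"] \<kappa>W by simp
    have "\<xi> (req_graph j) (\<zeta> (Suc j) z) i = \<psi> (\<zeta> 0 (z(j := i)))" if "i < k j" for i
    proof (rule LIMSEQ_unique)
      show "(\<lambda>n. \<xi> (req_graph j) (W n) i) \<longlonglongrightarrow> \<xi> (req_graph j) (\<zeta> (Suc j) z) i"
        by (rule continuous_on_tendsto_compose[OF cont_\<xi> W]) (use that \<kappa>W \<kappa>\<zeta> in auto)
      have "(\<lambda>n. E (n + Suc j) 0 (z(j := i))) \<longlonglongrightarrow> \<zeta> 0 (z(j := i))"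
        by (rule LIMSEQ_ignore_initial_segment[OF lim])
      then have "(\<lambda>n. \<psi> (E (n + Suc j) 0 (z(j := i)))) \<longlonglongrightarrow> \<psi> (\<zeta> 0 (z(j := i)))"
        by (rule continuous_on_tendsto_compose[OF cont_\<psi>]) auto
      moreover have "\<psi> (E (n + Suc j) 0 (z(j := i))) = \<xi> (req_graph j) (W n) i" for n
        unfolding W_def using edge[OF _ E, of "n + Suc j"] that by simp
      ultimately show "(\<lambda>n. \<xi> (req_graph j) (W n) i) \<longlonglongrightarrow> \<psi> (\<zeta> 0 (z(j := i)))" by simp
    qed
    with \<kappa>\<zeta> show ?thesis by blast
  qed
  ultimately show ?thesis using cont by (intro exI[of _ "range y"] exI[of _ "\<zeta> 0"] exI[of _ k]) blast
qed

text \<open>By Baire category, one of countably many covering Borel sets has a preimage under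
  \<open>\<lambda>z. \<psi> (\<phi> z)\<close> that is comeager in a nonempty open set. A request
  answered inside this open set yields an edge with all vertices in that Borel set.\<close>

lemma not_covered_by_borel:
  assumes "\<not> small (\<psi> ` V)"
  shows "\<exists>Y. infinite Y \<and> (\<forall>\<C>. countable \<C> \<longrightarrow> (\<forall>A\<in>\<C>. A \<in> sets borel \<and> (\<exists>m. free m A)) \<longrightarrow>
    \<not> \<psi> ` (\<Inter>y\<in>Y. T y) \<subseteq> \<Union>\<C>)"
proof -
  obtain Y \<phi> k where Y: "infinite Y" and cont: "continuous_on UNIV \<phi>"
    and in_T: "\<forall>z. \<forall>y\<in>Y. \<phi> z \<in> T y"
    and edge: "\<forall>n. \<forall>z\<in>cyl n (req_node n). \<exists>w. \<kappa> (req_graph n) w = k n \<and>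
       (\<forall>i<k n. \<xi> (req_graph n) w i = \<psi> (\<phi> (z(n := i))))"
    using ex_fusion[OF assms] by (elim exE conjE)
  have "\<not> \<psi> ` (\<Inter>y\<in>Y. T y) \<subseteq> \<Union>\<C>"
    if "countable \<C>" and \<C>: "\<forall>A\<in>\<C>. A \<in> sets borel \<and> (\<exists>m. free m A)" for \<C>
  proof
    assume cover: "\<psi> ` (\<Inter>y\<in>Y. T y) \<subseteq> \<Union>\<C>"
    define W where "W A = (\<lambda>z. \<psi> (\<phi> z)) -` A" for A
    have "(\<lambda>z. \<psi> (\<phi> z)) \<in> borel_measurable borel"
      by (intro borel_measurable_continuous_onI continuous_on_compose2[OF cont_\<psi> cont]) simp
    then have W: "W A \<in> sets borel" if "A \<in> \<C>" for A
      using \<C> that measurable_sets[of "\<lambda>z. \<psi> (\<phi> z)" borel borel A] by (simp add: W_def)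
    have "\<forall>A\<in>\<C>. \<exists>U. open U \<and> meager ((U - W A) \<union> (W A - U))"
      using borel_imp_baire_property[OF W] by (rule ballI)
    then obtain U where U: "\<forall>A\<in>\<C>. open (U A) \<and> meager ((U A - W A) \<union> (W A - U A))"
      by (rule bchoice[THEN exE])
    have "\<exists>A\<in>\<C>. U A \<noteq> {}"
    proof (rule ccontr)
      assume none: "\<not> ?thesis"
      have "meager (W A)" if "A \<in> \<C>" for A
        using U none that by auto
      then have "meager (\<Union>A\<in>\<C>. W A)" by (rule meager_UN[OF \<open>countable \<C>\<close>])
      moreover have "(\<Union>A\<in>\<C>. W A) = UNIV"
      proof (rule UNIV_eq_I[symmetric])
        fix z
        have "\<psi> (\<phi> z) \<in> \<Union>\<C>" using cover in_T by blast
        then show "z \<in> (\<Union>A\<in>\<C>. W A)" by (auto simp: W_def)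
      qed
      ultimately show False using open_not_meager[of "UNIV :: (nat \<Rightarrow> nat) set"] by simp
    qed
    then obtain A s where A: "A \<in> \<C>" "s \<in> U A" by blast
    obtain m where m: "free m A" using \<C> A(1) by blast
    obtain r where r: "cyl r s \<subseteq> U A" using cyl_subset_open[of "U A" s] U A by blast
    obtain n where n: "r \<le> n" "req_graph n = m" "req_node n \<in> cyl r s" using ex_req by blast
    \<comment> \<open>Changing entry \<open>n\<close> does not leave this cylinder either.\<close>
    have sub: "cyl n (req_node n) \<subseteq> U A"
      using r n(1,3) by (auto simp: cyl_def)
    have "meager (U A - W A)"
      using U A(1) meager_subset by blast
    then have "meager (\<Union>i<k n. {z. z(n := i) \<in> U A - W A})"
      by (intro meager_UN meager_vimage_fun_upd) auto
    \<comment> \<open>Each of the \<open>k n\<close> variants is bad only for a meager set of nodes,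
      so some node in the cylinder has only good variants.\<close>
    then have "\<not> cyl n (req_node n) \<subseteq> (\<Union>i<k n. {z. z(n := i) \<in> U A - W A})"
      using open_not_meager[OF open_cyl, of n "req_node n"] meager_subset
      by (auto simp: cyl_def)
    then obtain z where z: "z \<in> cyl n (req_node n)" "\<And>i. i < k n \<Longrightarrow> z(n := i) \<notin> U A - W A"
      by blast
    obtain w where w: "\<kappa> m w = k n" "\<And>i. i < k n \<Longrightarrow> \<xi> m w i = \<psi> (\<phi> (z(n := i)))"
      using edge z(1) n(2) by blast
    have "\<xi> m w i \<in> A" if "i < \<kappa> m w" for i
    proof -
      have "z(n := i) \<in> U A" using z(1) sub by (auto simp: cyl_def)
      then have "z(n := i) \<in> W A" using z(2) that w(1) by auto
      then show ?thesis using w that by (simp add: W_def)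
    qed
    then show False using m unfolding free_def by blast
  qed
  with Y show ?thesis by blast
qed

end

section \<open>Countable elementary submodels\<close>

instance fmla :: countable by countable_datatype

primrec var_bound :: "fmla \<Rightarrow> nat" where
  "var_bound (Mem i j) = Suc (max i j)"
| "var_bound (Eq i j) = Suc (max i j)"
| "var_bound (Neg \<phi>) = var_bound \<phi>"
| "var_bound (Conj \<phi> \<psi>) = max (var_bound \<phi>) (var_bound \<psi>)"
| "var_bound (All i \<phi>) = max (Suc i) (var_bound \<phi>)"

lemma sat_cong: "(\<And>i. i < var_bound \<phi> \<Longrightarrow> v i = v' i) \<Longrightarrow> sat M \<phi> v \<longleftrightarrow> sat M \<phi> v'"
proof (induction \<phi> arbitrary: v v')
  case (Neg \<phi>)
  have "sat M \<phi> v \<longleftrightarrow> sat M \<phi> v'" by (rule Neg.IH) (use Neg.prems in simp)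
  then show ?case by simp
next
  case (Conj \<phi> \<psi>)
  have "sat M \<phi> v \<longleftrightarrow> sat M \<phi> v'" by (rule Conj.IH(1)) (use Conj.prems in simp)
  moreover have "sat M \<psi> v \<longleftrightarrow> sat M \<psi> v'" by (rule Conj.IH(2)) (use Conj.prems in simp)
  ultimately show ?case by simp
next
  case (All i \<phi>)
  have "sat M \<phi> (v(i := x)) \<longleftrightarrow> sat M \<phi> (v'(i := x))" for x
    by (rule All.IH) (use All.prems in simp)
  then show ?case by simp
qed simp_all

text \<open>The Tarski-Vaught test; since \<open>All\<close> is the primitive quantifier, the
  witnesses are counterexamples.\<close>

lemma elementary_if_witnesses:
  assumes "M \<noteq> {}"
    and witness: "\<And>\<phi> i v. range v \<subseteq> M \<Longrightarrow> \<exists>x. \<not> sat UNIV \<phi> (v(i := x)) \<Longrightarrow>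
      \<exists>x\<in>M. \<not> sat UNIV \<phi> (v(i := x))"
  shows "elementary M"
proof -
  have "sat M \<phi> v \<longleftrightarrow> sat UNIV \<phi> v" if "range v \<subseteq> M" for \<phi> v
    using that
  proof (induction \<phi> arbitrary: v)
    case (All i \<phi>)
    have "sat M \<phi> (v(i := x)) \<longleftrightarrow> sat UNIV \<phi> (v(i := x))" if "x \<in> M" for x
      by (rule All.IH) (use All.prems that in auto)
    then have "sat M (All i \<phi>) v \<longleftrightarrow> (\<forall>x\<in>M. sat UNIV \<phi> (v(i := x)))" by simp
    also have "\<dots> \<longleftrightarrow> sat UNIV (All i \<phi>) v" using witness[OF All.prems, of \<phi> i] by auto
    finally show ?case .
  qed simp_all
  with \<open>M \<noteq> {}\<close> show ?thesis unfolding elementary_def by blast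
qed

text \<open>Downward Loewenheim-Skolem, by closing under Skolem functions.\<close>

lemma ex_countable_elementary:
  fixes S :: "'k hset set"
  assumes "countable S"
  shows "\<exists>M. S \<subseteq> M \<and> countable M \<and> elementary M"
proof -
  fix x0 :: "'k hset"
  \<comment> \<open>A formula has finitely many variables, so finite lists, padded with
    \<open>x0\<close>, represent all assignments and keep the hull countable.\<close>
  define asg where "asg l = (\<lambda>j. if j < length l then l ! j else x0)" for l
  define sk where "sk = (\<lambda>(\<phi>, i, l). SOME x. \<not> sat UNIV \<phi> ((asg l)(i := x)))"
  define H where "H = rec_nat (insert x0 S) (\<lambda>_ A. A \<union> sk ` (UNIV \<times> UNIV \<times> lists A))"
  have H0: "H 0 = insert x0 S" and HS: "\<And>n. H (Suc n) = H n \<union> sk ` (UNIV \<times> UNIV \<times> lists (H n))"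
    by (simp_all add: H_def)
  define M where "M = (\<Union>n. H n)"
  have "countable (H n)" for n
    by (induction n) (use assms in \<open>auto simp: H0 HS intro!: countable_image countable_SIGMA\<close>)
  then have "countable M" unfolding M_def by simp
  have mono: "m \<le> n \<Longrightarrow> H m \<subseteq> H n" for m n
    by (rule lift_Suc_mono_le[of H]) (auto simp: HS)
  have in_lists: "\<exists>n. l \<in> lists (H n)" if "set l \<subseteq> M" for l
    using that
  proof (induction l)
    case (Cons a l)
    then obtain m n where "a \<in> H m" "l \<in> lists (H n)" unfolding M_def by auto
    then have "a # l \<in> lists (H (max m n))"
      using mono[of m "max m n"] mono[of n "max m n"] lists_mono[of "H n" "H (max m n)"] by auto
    then show ?case by blast
  qed simp
  have "elementary M"
  proof (rule elementary_if_witnesses)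
    show "M \<noteq> {}" using H0 by (auto simp: M_def)
    fix \<phi> i and v :: "nat \<Rightarrow> 'k hset"
    assume v: "range v \<subseteq> M" and ex: "\<exists>x. \<not> sat UNIV \<phi> (v(i := x))"
    define l where "l = map v [0..<var_bound \<phi>]"
    have asg: "sat UNIV \<phi> ((asg l)(i := x)) \<longleftrightarrow> sat UNIV \<phi> (v(i := x))" for x
      by (rule sat_cong) (simp add: asg_def l_def)
    have "set l \<subseteq> M" using v by (auto simp: l_def)
    then obtain n where "l \<in> lists (H n)" using in_lists by blast
    then have "sk (\<phi>, i, l) \<in> H (Suc n)" unfolding HS by blast
    then have "sk (\<phi>, i, l) \<in> M" unfolding M_def by blast
    moreover have "\<not> sat UNIV \<phi> (v(i := sk (\<phi>, i, l)))"
      unfolding sk_def prod.case asg using ex by (rule someI_ex)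
    ultimately show "\<exists>x\<in>M. \<not> sat UNIV \<phi> (v(i := x))" by blast
  qed
  moreover have "S \<subseteq> M" using H0 by (auto simp: M_def)
  ultimately show ?thesis using \<open>countable M\<close> by blast
qed

section \<open>Hypergraph ideals\<close>

lemma hypergraph_ideal_subset: "A \<in> hypergraph_ideal \<G> \<Longrightarrow> A' \<subseteq> A \<Longrightarrow> A' \<in> hypergraph_ideal \<G>"
  unfolding hypergraph_ideal_def mem_Collect_eq by (meson subset_trans)

lemma empty_in_hypergraph_ideal: "{} \<in> hypergraph_ideal \<G>"
  unfolding hypergraph_ideal_def by (intro CollectI exI[of _ "{}"]) simp

lemma hypergraph_ideal_UN:
  assumes "countable I" "\<And>i. i \<in> I \<Longrightarrow> A i \<in> hypergraph_ideal \<G>"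
  shows "(\<Union>i\<in>I. A i) \<in> hypergraph_ideal \<G>"
proof -
  have "\<forall>i\<in>I. \<exists>F. countable F \<and> F \<subseteq> {B \<in> sets borel. \<exists>G\<in>\<G>. anticlique G B} \<and> A i \<subseteq> \<Union>F"
    using assms(2) unfolding hypergraph_ideal_def mem_Collect_eq by (rule ballI)
  then obtain F where F: "\<forall>i\<in>I. countable (F i) \<and>
      F i \<subseteq> {B \<in> sets borel. \<exists>G\<in>\<G>. anticlique G B} \<and> A i \<subseteq> \<Union>(F i)"
    by (rule bchoice[THEN exE])
  have "countable (\<Union>i\<in>I. F i)"
    using assms(1) F by (intro countable_UN) (simp_all only: Ball_def)
  moreover have "(\<Union>i\<in>I. F i) \<subseteq> {B \<in> sets borel. \<exists>G\<in>\<G>. anticlique G B}"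
    by (rule UN_least) (use F in \<open>simp only: Ball_def\<close>)
  moreover have "(\<Union>i\<in>I. A i) \<subseteq> \<Union>(\<Union>i\<in>I. F i)"
  proof (rule UN_least)
    fix i assume "i \<in> I"
    then have "A i \<subseteq> \<Union>(F i)" using F by (simp only: Ball_def)
    also have "\<dots> \<subseteq> \<Union>(\<Union>i\<in>I. F i)" using \<open>i \<in> I\<close> by blast
    finally show "A i \<subseteq> \<Union>(\<Union>i\<in>I. F i)" .
  qed
  ultimately show ?thesis unfolding hypergraph_ideal_def by blast
qed

text \<open>The codes of an edge are its preimages under a continuous surjection onto
  \<open>G\<close>. Finiteness makes the length a natural number, the sum topology makes it locally
  constant, and \<open>anticlique G {}\<close> excludes the empty edge, since the empty sequence
  lies in \<open>seqs {}\<close>.\<close>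

lemma analytic_hypergraph_codes:
  fixes G :: "'a::topological_space hypergraph"
  assumes "analytic_in seq_topology G" "G \<noteq> {}" "\<forall>e\<in>G. fst e < \<infinity>" "anticlique G {}"
  shows "\<exists>\<kappa> (\<xi> :: (nat \<Rightarrow> nat) \<Rightarrow> nat \<Rightarrow> 'a). (\<forall>w. \<kappa> w > 0) \<and> (\<forall>k. closed {w. \<kappa> w = k}) \<and>
    (\<forall>i. continuous_on {w. i < \<kappa> w} (\<lambda>w. \<xi> w i)) \<and>
    (\<forall>A. anticlique G A \<longleftrightarrow> (\<nexists>w. \<forall>i<\<kappa> w. \<xi> w i \<in> A))"
proof -
  obtain f where f: "continuous_map (euclidean :: (nat \<Rightarrow> nat) topology) seq_topology f" "range f = G"
    using assms(1,2) unfolding analytic_in_def by blast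
  define \<kappa> where "\<kappa> w = the_enat (fst (f w))" for w
  define \<xi> where "\<xi> w = snd (f w)" for w
  have f_in: "f w \<in> seqs UNIV" for w
    using continuous_map_image_subset_topspace[OF f(1)] by (auto simp: topspace_seq_topology)
  have fst_f: "fst (f w) = enat (\<kappa> w)" for w
  proof -
    have "fst (f w) < \<infinity>" using assms(3) f(2) by blast
    then show ?thesis by (cases "fst (f w)") (simp_all add: \<kappa>_def)
  qed
  have f_seqs: "f w \<in> seqs A \<longleftrightarrow> (\<forall>i<\<kappa> w. \<xi> w i \<in> A)" for w A
    using f_in[of w] fst_f[of w]
    by (cases "f w") (auto simp: seqs_def \<xi>_def PiE_iff)
  have anticlique: "anticlique G A \<longleftrightarrow> (\<nexists>w. \<forall>i<\<kappa> w. \<xi> w i \<in> A)" for A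
    unfolding anticlique_def f_seqs[symmetric] using f(2) by blast
  have "\<kappa> w > 0" for w
  proof (rule ccontr)
    assume "\<not> \<kappa> w > 0"
    then have "\<forall>i<\<kappa> w. \<xi> w i \<in> {}" by simp
    then show False using assms(4) unfolding anticlique by blast
  qed
  moreover have op: "open (f -` U)" if "openin seq_topology U" for U
    using openin_continuous_map_preimage[OF f(1) that] by (simp add: vimage_def)
  have fiber: "{w. \<kappa> w = k} = f -` (seqs UNIV \<inter> {enat k} \<times> UNIV)" for k
  proof -
    have "\<kappa> w = k \<longleftrightarrow> f w \<in> seqs UNIV \<inter> {enat k} \<times> UNIV" for w
      using f_in[of w] fst_f[of w] by (cases "f w") simp
    then show ?thesis by (intro set_eqI) (simp only: mem_Collect_eq vimage_eq)
  qed
  have open_fiber: "open {w. \<kappa> w = k}" for k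
  proof -
    define U :: "'a hypergraph" where "U = seqs UNIV \<inter> {enat k} \<times> UNIV"
    have "openin (product_topology (\<lambda>_. euclidean) {i. enat i < n}) {x. (n, x) \<in> U}" for n
    proof (cases "n = enat k")
      case True
      then have "{x. (n, x) \<in> U} = topspace (product_topology (\<lambda>_. euclidean) {i. enat i < n})"
        by (simp add: U_def seqs_def)
      then show ?thesis by (simp only: openin_topspace)
    qed (simp add: U_def)
    then have "openin seq_topology U"
      by (auto simp: seq_topology_def openin_sum_topology U_def seqs_def)
    then show ?thesis unfolding fiber U_def by (rule op)
  qed
  have "closed {w. \<kappa> w = k}" for k
  proof -
    have "- {w. \<kappa> w = k} = (\<Union>k'\<in>-{k}. {w. \<kappa> w = k'})" by auto
    then show ?thesis using open_fiber by (simp add: closed_def open_UN)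
  qed
  moreover have "continuous_on {w. i < \<kappa> w} (\<lambda>w. \<xi> w i)" for i
  proof -
    have "{w. i < \<kappa> w} = (\<Union>k\<in>{i<..}. {w. \<kappa> w = k})" by auto
    then have "open {w. i < \<kappa> w}" using open_fiber by (simp add: open_UN)
    moreover have "open ((\<lambda>w. \<xi> w i) -` B \<inter> {w. i < \<kappa> w})" if "open B" for B
    proof -
      define U where "U = seqs UNIV \<inter> {(n, x). enat i < n \<and> x i \<in> B}"
      have "openin (product_topology (\<lambda>_. euclidean) {i. enat i < n}) {x. (n, x) \<in> U}" for n
      proof (cases "enat i < n")
        case True
        then have "continuous_map (product_topology (\<lambda>_. euclidean) {i. enat i < n}) euclidean (\<lambda>x :: nat \<Rightarrow> 'a. x i)"
          by (intro continuous_map_product_projection) simp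
        from openin_continuous_map_preimage[OF this, of B] that True show ?thesis
          by (simp add: U_def seqs_def Collect_conj_eq)
      qed (simp add: U_def)
      then have "openin seq_topology U"
        by (auto simp: seq_topology_def openin_sum_topology U_def seqs_def)
      moreover have "(\<lambda>w. \<xi> w i) -` B \<inter> {w. i < \<kappa> w} = f -` U"
      proof -
        have "f w \<in> U \<longleftrightarrow> \<xi> w i \<in> B \<and> i < \<kappa> w" for w
          using f_in[of w] fst_f[of w] by (cases "f w") (auto simp: U_def \<xi>_def)
        then show ?thesis by (intro set_eqI) (simp only: Int_iff mem_Collect_eq vimage_eq)
      qed
      ultimately show ?thesis using op by simp
    qed
    ultimately show ?thesis by (simp add: continuous_on_open_vimage)
  qed
  ultimately show ?thesis using anticlique by (intro exI[of _ \<kappa>] exI[of _ \<xi>]) simp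
qed

text \<open>The space \<open>'v \<Rightarrow> bool\<close> is compact by Tychonoff, and finitely
  many coordinates determine a basic neighbourhood of the cluster point.\<close>

lemma ex_cluster_point:
  fixes I :: "nat \<Rightarrow> 'v \<Rightarrow> bool"
  shows "\<exists>g. \<forall>F n. finite F \<longrightarrow> (\<exists>y\<ge>n. \<forall>v\<in>F. I y v = g v)"
proof -
  have "compactin (product_topology (\<lambda>_. euclidean) UNIV) (\<Pi>\<^sub>E v\<in>(UNIV :: 'v set). (UNIV :: bool set))"
    unfolding compactin_PiE by (simp add: finite_imp_compact)
  then have "compact (UNIV :: ('v \<Rightarrow> bool) set)"
    by (simp add: euclidean_product_topology)
  moreover have "filtermap I sequentially \<noteq> bot" by (simp add: filtermap_bot_iff)
  ultimately obtain g where g: "inf (nhds g) (filtermap I sequentially) \<noteq> bot"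
    unfolding compact_filter by auto
  have "\<exists>y\<ge>n. \<forall>v\<in>F. I y v = g v" if "finite F" for F n
  proof (rule ccontr)
    assume none: "\<not> ?thesis"
    define U where "U = (\<Inter>v\<in>F. (\<lambda>x. x v) -` {g v})"
    have "open U"
      unfolding U_def
      by (intro open_INT \<open>finite F\<close> ballI open_vimage open_discrete continuous_on_product_coordinates)
    moreover have "g \<in> U" by (simp add: U_def)
    ultimately have "\<forall>\<^sub>F x in nhds g. x \<in> U" by (rule eventually_nhds_in_open)
    moreover have "\<forall>\<^sub>F x in filtermap I sequentially. x \<notin> U"
      unfolding eventually_filtermap
      by (rule eventually_sequentiallyI[of n]) (use none in \<open>auto simp: U_def\<close>)
    ultimately have "\<forall>\<^sub>F x in inf (nhds g) (filtermap I sequentially). False"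
      unfolding eventually_inf by blast
    with g show False by (simp add: eventually_False)
  qed
  then show ?thesis by blast
qed

section \<open>Homogeneous sets\<close>

lemma borel_vimage:
  assumes "continuous_on UNIV f" "A \<in> sets borel"
  shows "f -` A \<in> sets borel"
  using measurable_sets[OF borel_measurable_continuous_onI[OF assms(1)] assms(2)] by simp

text \<open>A point of \<open>q\<close> may lie in both \<open>Z n True\<close> and
  \<open>Z n False\<close>. Parametrizing the Borel set of points paired with admissible choices,
  instead of \<open>q\<close>, makes the chosen bits depend continuously on the code.\<close>

lemma ex_parametrization:
  fixes q :: "'a::polish_space set" and Z :: "nat \<Rightarrow> bool \<Rightarrow> 'a set"
  assumes q: "q \<in> sets borel" "q \<noteq> {}" and Z: "\<And>n b. Z n b \<in> sets borel"
    and cover: "\<And>n. q \<subseteq> Z n True \<union> Z n False"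
  shows "\<exists>\<psi> (I :: nat \<Rightarrow> (nat \<Rightarrow> nat) \<Rightarrow> bool). continuous_on UNIV \<psi> \<and> range \<psi> = q \<and>
    (\<forall>n b. closed {v. I n v = b}) \<and> (\<forall>n v. \<psi> v \<in> Z n (I n v))"
proof -
  \<comment> \<open>Bits are coded by natural numbers, 1 meaning \<open>True\<close> and every other
    value \<open>False\<close>, so that the choices form a point of the Baire space.\<close>
  define Q :: "('a \<times> (nat \<Rightarrow> nat)) set"
    where "Q = {(x, b). x \<in> q \<and> (\<forall>n. x \<in> Z n (b n = 1))}"
  define R where "R n = {p :: 'a \<times> (nat \<Rightarrow> nat). fst p \<in> Z n (snd p n = 1)}" for n
  have Q: "Q = fst -` q \<inter> (\<Inter>n. R n)"
    by (auto simp: Q_def R_def)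
  have R: "R n = (fst -` Z n True \<inter> (\<lambda>p. snd p n) -` {1}) \<union>
      (fst -` Z n False \<inter> (\<lambda>p. snd p n) -` (- {1}))" for n
  proof (rule set_eqI)
    fix p
    show "p \<in> R n \<longleftrightarrow> p \<in> (fst -` Z n True \<inter> (\<lambda>p. snd p n) -` {1}) \<union>
      (fst -` Z n False \<inter> (\<lambda>p. snd p n) -` (- {1}))"
      by (cases "snd p n = 1") (simp_all add: R_def)
  qed
  have "continuous_on UNIV (\<lambda>p :: 'a \<times> (nat \<Rightarrow> nat). snd p n)" for n
    by (rule continuous_on_product_then_coordinatewise) (intro continuous_on_snd continuous_on_id)
  then have snd_borel: "(\<lambda>p :: 'a \<times> (nat \<Rightarrow> nat). snd p n) -` B \<in> sets borel" for n B
    by (rule borel_vimage) (simp add: borel_open open_discrete)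
  have fst_borel: "fst -` A \<in> sets (borel :: ('a \<times> (nat \<Rightarrow> nat)) measure)" if "A \<in> sets borel" for A
    using that by (intro borel_vimage continuous_on_fst continuous_on_id)
  have "R n \<in> sets borel" for n
    unfolding R by (intro sets.Int sets.Un snd_borel fst_borel Z)
  then have "Q \<in> sets borel"
    unfolding Q by (intro sets.Int fst_borel q(1) sets.countable_INT') auto
  then have "analytic_in euclidean Q" by (rule borel_imp_analytic)
  moreover have fst_Q: "fst ` Q = q"
  proof
    show "q \<subseteq> fst ` Q"
    proof
      fix x assume "x \<in> q"
      then have "(x, \<lambda>n. if x \<in> Z n True then 1 else 0) \<in> Q"
        using cover by (auto simp: Q_def)
      then show "x \<in> fst ` Q" by force
    qed
  qed (auto simp: Q_def)
  ultimately obtain h :: "(nat \<Rightarrow> nat) \<Rightarrow> 'a \<times> (nat \<Rightarrow> nat)" where h: "continuous_on UNIV h" "range h = Q"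
    using q(2) unfolding analytic_in_def by auto
  define \<psi> where "\<psi> v = fst (h v)" for v
  define I where "I n v \<longleftrightarrow> snd (h v) n = 1" for n v
  have "continuous_on UNIV \<psi>" unfolding \<psi>_def by (intro continuous_on_fst h(1))
  moreover have "range \<psi> = q"
    unfolding \<psi>_def fst_Q[symmetric] h(2)[symmetric] by (simp add: image_image)
  moreover have "closed {v. I n v = b}" for n b
  proof -
    have "continuous_on UNIV (\<lambda>v. snd (h v) n)"
      by (rule continuous_on_product_then_coordinatewise) (intro continuous_on_snd h(1))
    then have "closed ((\<lambda>v. snd (h v) n) -` {i. (i = 1) = b})"
      by (intro closed_vimage) (auto simp: closed_def open_discrete)
    moreover have "{v. I n v = b} = (\<lambda>v. snd (h v) n) -` {i. (i = 1) = b}"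
      by (simp add: I_def vimage_def)
    ultimately show ?thesis by (simp only:)
  qed
  moreover have "\<psi> v \<in> Z n (I n v)" for n v
  proof -
    have "h v \<in> Q" unfolding h(2)[symmetric] by (rule rangeI)
    then show ?thesis by (simp add: Q_def \<psi>_def I_def case_prod_beta)
  qed
  ultimately show ?thesis by blast
qed

lemma ex_homogeneous:
  fixes \<G> :: "'a::polish_space hypergraph set" and Z :: "nat \<Rightarrow> bool \<Rightarrow> 'a set"
  assumes "countable \<G>"
    and analytic: "\<And>G. G \<in> \<G> \<Longrightarrow> analytic_in seq_topology G"
    and sap: "small_anticlique_property \<G>"
    and finite_edges: "\<And>G. G \<in> \<G> \<Longrightarrow> \<forall>e\<in>G. fst e < \<infinity>"
    and q: "q \<in> sets borel" "q \<notin> hypergraph_ideal \<G>" and Z: "\<And>n b. Z n b \<in> sets borel"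
    and cover: "\<And>n. q \<subseteq> Z n True \<union> Z n False"
  shows "\<exists>b Y. infinite Y \<and> q \<inter> (\<Inter>n\<in>Y. Z n b) \<notin> hypergraph_ideal \<G>"
proof -
  have "q \<noteq> {}" using q(2) empty_in_hypergraph_ideal by blast
  then obtain \<psi> and I :: "nat \<Rightarrow> (nat \<Rightarrow> nat) \<Rightarrow> bool" where \<psi>: "continuous_on UNIV \<psi>" "range \<psi> = q"
    and closed_I: "\<And>n b. closed {v. I n v = b}" and in_Z: "\<And>n v. \<psi> v \<in> Z n (I n v)"
    using ex_parametrization[where Z = Z, OF q(1) _ Z cover] by blast
  obtain g where g: "\<And>F n. finite F \<Longrightarrow> \<exists>y\<ge>n. \<forall>v\<in>F. I y v = g v"
    using ex_cluster_point[of I] by blast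
  \<comment> \<open>A hypergraph containing the empty edge has no anticlique at all, so it
    contributes nothing to the ideal; dropping it leaves edges of positive length.\<close>
  define \<G>' where "\<G>' = {G \<in> \<G>. anticlique G {}}"
  have \<G>': "\<exists>G\<in>\<G>'. anticlique G B" if "G \<in> \<G>" "anticlique G B" for G B
  proof -
    have "seqs {} \<subseteq> seqs B" by (auto simp: seqs_def PiE_iff)
    with that(2) have "anticlique G {}" unfolding anticlique_def by blast
    with that show ?thesis unfolding \<G>'_def by blast
  qed
  have in_q: "\<psi> v \<in> q \<inter> (\<Inter>n\<in>Y. Z n b)" if Y: "\<And>n. n \<in> Y \<Longrightarrow> I n v = b" for v b Y
  proof -
    have "\<psi> v \<in> q" unfolding \<psi>(2)[symmetric] by (rule rangeI)
    moreover have "\<psi> v \<in> Z n b" if "n \<in> Y" for n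
      using in_Z[of v n] unfolding Y[OF that] .
    ultimately show ?thesis by blast
  qed
  show ?thesis
  proof (cases "\<G>' = {}")
    case True
    \<comment> \<open>Without anticliques the ideal contains only the empty set, so a single point
      in the intersection is enough.\<close>
    fix v0
    define Y where "Y = {n. I n v0 = g v0}"
    have "\<exists>y\<ge>n. y \<in> Y" for n using g[of "{v0}" n] by (simp add: Y_def)
    then have "infinite Y" unfolding infinite_nat_iff_unbounded_le by blast
    moreover have "\<psi> v0 \<in> q \<inter> (\<Inter>n\<in>Y. Z n (g v0))"
      by (rule in_q) (simp add: Y_def)
    moreover have "A = {}" if A: "A \<in> hypergraph_ideal \<G>" for A
    proof -
      obtain F where "F \<subseteq> {B \<in> sets borel. \<exists>G\<in>\<G>. anticlique G B}" "A \<subseteq> \<Union>F"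
        using A unfolding hypergraph_ideal_def mem_Collect_eq by (elim exE conjE)
      moreover have "{B \<in> sets borel. \<exists>G\<in>\<G>. anticlique G B} = {}" using \<G>' True by blast
      ultimately show ?thesis by blast
    qed
    ultimately show ?thesis by blast
  next
    case False
    define Gs where "Gs = from_nat_into \<G>'"
    have "countable \<G>'" using \<open>countable \<G>\<close> unfolding \<G>'_def by simp
    then have Gs: "range Gs = \<G>'" unfolding Gs_def using False by (intro range_from_nat_into)
    have Gs_in: "Gs m \<in> \<G>" "anticlique (Gs m) {}" for m
      using rangeI[of Gs m] unfolding Gs \<G>'_def by blast+
    have "\<exists>\<kappa> (\<xi> :: (nat \<Rightarrow> nat) \<Rightarrow> nat \<Rightarrow> 'a). (\<forall>w. \<kappa> w > 0) \<and> (\<forall>k. closed {w. \<kappa> w = k}) \<and>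
      (\<forall>i. continuous_on {w. i < \<kappa> w} (\<lambda>w. \<xi> w i)) \<and>
      (\<forall>A. anticlique (Gs m) A \<longleftrightarrow> (\<nexists>w. \<forall>i<\<kappa> w. \<xi> w i \<in> A))" for m
    proof (rule analytic_hypergraph_codes[OF analytic _ finite_edges])
      \<comment> \<open>An empty hypergraph would make the whole space an anticlique.\<close>
      show "Gs m \<noteq> {}"
      proof
        assume "Gs m = {}"
        then have "anticlique (Gs m) UNIV" by (simp add: anticlique_def)
        then have "q \<in> hypergraph_ideal \<G>"
          unfolding hypergraph_ideal_def using Gs_in(1) by (intro CollectI exI[of _ "{UNIV}"]) auto
        with q(2) show False by contradiction
      qed
    qed (use Gs_in in auto)
    then have "\<forall>m. \<exists>\<kappa> (\<xi> :: (nat \<Rightarrow> nat) \<Rightarrow> nat \<Rightarrow> 'a). (\<forall>w. \<kappa> w > 0) \<and> (\<forall>k. closed {w. \<kappa> w = k}) \<and>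
      (\<forall>i. continuous_on {w. i < \<kappa> w} (\<lambda>w. \<xi> w i)) \<and>
      (\<forall>A. anticlique (Gs m) A \<longleftrightarrow> (\<nexists>w. \<forall>i<\<kappa> w. \<xi> w i \<in> A))" by (rule allI)
    from choice[OF this] obtain \<kappa> where "\<forall>m. \<exists>\<xi> :: (nat \<Rightarrow> nat) \<Rightarrow> nat \<Rightarrow> 'a.
      (\<forall>w. \<kappa> m w > 0) \<and> (\<forall>k. closed {w. \<kappa> m w = k}) \<and>
      (\<forall>i. continuous_on {w. i < \<kappa> m w} (\<lambda>w. \<xi> w i)) \<and>
      (\<forall>A. anticlique (Gs m) A \<longleftrightarrow> (\<nexists>w. \<forall>i<\<kappa> m w. \<xi> w i \<in> A))" by (rule exE)
    from choice[OF this] obtain \<xi> :: "nat \<Rightarrow> (nat \<Rightarrow> nat) \<Rightarrow> nat \<Rightarrow> 'a" where codes: "\<forall>m.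
      (\<forall>w. \<kappa> m w > 0) \<and> (\<forall>k. closed {w. \<kappa> m w = k}) \<and>
      (\<forall>i. continuous_on {w. i < \<kappa> m w} (\<lambda>w. \<xi> m w i)) \<and>
      (\<forall>A. anticlique (Gs m) A \<longleftrightarrow> (\<nexists>w. \<forall>i<\<kappa> m w. \<xi> m w i \<in> A))" by (rule exE)
    interpret E: edge_family \<kappa> \<xi> \<psi> "\<lambda>n. {v. I n v = b}" "{v. g v = b}" for b
    proof
      fix F :: "(nat \<Rightarrow> nat) set" and n
      assume F: "finite F" "F \<subseteq> {v. g v = b}"
      obtain y where y: "y \<ge> n" "\<forall>v\<in>F. I y v = g v" using g[OF F(1)] by blast
      have "F \<subseteq> {v. I y v = b}"
      proof
        fix v assume "v \<in> F"
        then have "I y v = g v" "g v = b" using y(2) F(2) by blast+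
        then show "v \<in> {v. I y v = b}" by simp
      qed
      with y(1) show "\<exists>y\<ge>n. F \<subseteq> {v. I y v = b}" by blast
    qed (use codes \<psi>(1) closed_I in simp_all)
    have free: "E.free m A \<longleftrightarrow> anticlique (Gs m) A" for m A
      using codes unfolding E.free_def by (simp only: simp_thms)
    \<comment> \<open>If both halves were small, \<open>q\<close> would be a positive analytic set
      covered by countably many arbitrary anticliques.\<close>
    have "\<exists>b. \<not> E.small (\<psi> ` {v. g v = b})"
    proof (rule ccontr)
      assume "\<nexists>b. \<not> E.small (\<psi> ` {v. g v = b})"
      then have "E.small (\<psi> ` {v. g v = True} \<union> \<psi> ` {v. g v = False})"
        by (intro E.small_Un) blast+
      also have "\<psi> ` {v. g v = True} \<union> \<psi> ` {v. g v = False} = q"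
        unfolding \<psi>(2)[symmetric] by auto
      finally obtain \<C> where \<C>: "countable \<C>" "\<forall>A\<in>\<C>. \<exists>m. anticlique (Gs m) A" "q \<subseteq> \<Union>\<C>"
        unfolding E.small_def free by blast
      have "\<C> \<noteq> {}" using \<C>(3) \<open>q \<noteq> {}\<close> by blast
      define B where "B = from_nat_into \<C>"
      have B: "range B = \<C>" unfolding B_def using \<C>(1) \<open>\<C> \<noteq> {}\<close> by (intro range_from_nat_into)
      have "\<forall>n. \<exists>m. anticlique (Gs m) (B n)" using \<C>(2) rangeI[of B] unfolding B by blast
      from choice[OF this] obtain m where m: "\<forall>n. anticlique (Gs (m n)) (B n)" by (rule exE)
      have "q \<subseteq> (\<Union>n. B n)" using \<C>(3) unfolding B[symmetric] .
      moreover have "\<forall>n. Gs (m n) \<in> \<G> \<and> anticlique (Gs (m n)) (B n)" using m Gs_in by blast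
      ultimately show False
        using sap borel_imp_analytic[OF q(1)] q(2) unfolding small_anticlique_property_def
        by (auto dest!: spec[of _ B] spec[of _ "\<lambda>n. Gs (m n)"])
    qed
    then obtain b where "\<not> E.small (\<psi> ` {v. g v = b})" by (rule exE)
    then obtain Y where Y: "infinite Y"
      "\<forall>\<C>. countable \<C> \<longrightarrow> (\<forall>A\<in>\<C>. A \<in> sets borel \<and> (\<exists>m. anticlique (Gs m) A)) \<longrightarrow>
        \<not> \<psi> ` (\<Inter>y\<in>Y. {v. I y v = b}) \<subseteq> \<Union>\<C>"
      using E.not_covered_by_borel[of b] unfolding free by blast
    have "q \<inter> (\<Inter>n\<in>Y. Z n b) \<notin> hypergraph_ideal \<G>"
    proof
      assume "q \<inter> (\<Inter>n\<in>Y. Z n b) \<in> hypergraph_ideal \<G>"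
      then obtain F where F: "countable F" "F \<subseteq> {B \<in> sets borel. \<exists>G\<in>\<G>. anticlique G B}"
        "q \<inter> (\<Inter>n\<in>Y. Z n b) \<subseteq> \<Union>F"
        unfolding hypergraph_ideal_def mem_Collect_eq by (elim exE conjE)
      have "A \<in> sets borel \<and> (\<exists>m. anticlique (Gs m) A)" if A: "A \<in> F" for A
      proof -
        obtain G where "A \<in> sets borel" "G \<in> \<G>" "anticlique G A" using F(2) A by blast
        moreover from this obtain G' where "G' \<in> \<G>'" "anticlique G' A" using \<G>' by blast
        ultimately show ?thesis unfolding Gs[symmetric] by blast
      qed
      moreover have "\<psi> ` (\<Inter>y\<in>Y. {v. I y v = b}) \<subseteq> \<Union>F"
      proof (rule image_subsetI)
        fix v assume v: "v \<in> (\<Inter>y\<in>Y. {v. I y v = b})"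
        have "\<psi> v \<in> q \<inter> (\<Inter>n\<in>Y. Z n b)" by (rule in_q) (use v in blast)
        then show "\<psi> v \<in> \<Union>F" using F(3) by (rule rev_subsetD)
      qed
      ultimately show False using Y(2) F(1) by blast
    qed
    with Y(1) show ?thesis by blast
  qed
qed

section \<open>Reading a name for a real through a generic condition\<close>

theorem corollary3p57:
  fixes \<G> :: "'a::polish_space hypergraph set"
  assumes "countable \<G>"
    and "\<forall>G\<in>\<G>. analytic_in seq_topology G"
    and "small_anticlique_property \<G>"
    and "\<forall>G\<in>\<G>. \<forall>e\<in>G. fst e < \<infinity>"
    and "proper_forcing (quotient_poset (hypergraph_ideal \<G>)) (\<subseteq>)"
  shows "\<not> adds_independent_real (quotient_poset (hypergraph_ideal \<G>)) (\<subseteq>)"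
proof
  define I where "I = hypergraph_ideal \<G>"
  define P where "P = quotient_poset I"
  have P: "A \<in> P \<longleftrightarrow> A \<in> sets borel \<and> A \<notin> I" for A
    by (simp add: P_def quotient_poset_def)
  have I_subset: "A \<in> I \<Longrightarrow> A' \<subseteq> A \<Longrightarrow> A' \<in> I" for A A'
    unfolding I_def by (rule hypergraph_ideal_subset)
  assume "adds_independent_real (quotient_poset (hypergraph_ideal \<G>)) (\<subseteq>)"
  then obtain p \<tau> where p: "p \<in> P" and real: "forces_real P (\<subseteq>) \<tau> p"
    and independent: "forces_independent P (\<subseteq>) \<tau> p"
    unfolding adds_independent_real_def P_def I_def by blast
  define dec where "dec n b = {d \<in> P. forces_mem P (\<subseteq>) (n, b) \<tau> d}" for n b
  \<comment> \<open>The conditions incompatible with \<open>p\<close> are added because properness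
    speaks of sets dense in the whole poset.\<close>
  define D where "D n = {d \<in> P. d \<inter> p \<in> I} \<union> (\<Union>b. dec n b)" for n
  have D: "dense_in P (\<subseteq>) (D n)" for n
    unfolding dense_in_def
  proof (intro conjI ballI)
    show "D n \<subseteq> P" by (auto simp: D_def dec_def)
    fix r assume r: "r \<in> P"
    show "\<exists>d\<in>D n. d \<subseteq> r"
    proof (cases "r \<inter> p \<in> I")
      case True
      with r show ?thesis by (auto simp: D_def)
    next
      case False
      then have "r \<inter> p \<in> P" using r p unfolding P by (blast intro: sets.Int)
      moreover have "forces_ex P (\<subseteq>) UNIV (\<lambda>b. forces_mem P (\<subseteq>) (n, b) \<tau>) p"
        using real unfolding forces_real_def forces_all_def by blast
      ultimately obtain d b where "d \<in> P" "d \<subseteq> r \<inter> p" "forces_mem P (\<subseteq>) (n, b) \<tau> d"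
        unfolding forces_ex_def by (meson inf_le2)
      then show ?thesis by (auto simp: D_def dec_def)
    qed
  qed
  obtain c :: "'a set \<Rightarrow> ('a set + nat) set hset" where c: "inj c" using ex_hset_copy by blast
  \<comment> \<open>The countably many sets \<open>D n\<close> are put into the model
    directly.\<close>
  obtain M where M: "countable M" "elementary M" "HSet (c ` P) \<in> M"
    "HSet {hpair (c p) (c q) |p q. p \<in> P \<and> q \<in> P \<and> p \<subseteq> q} \<in> M" "c p \<in> M" "\<And>n. HSet (c ` D n) \<in> M"
    using ex_countable_elementary[of "{HSet (c ` P), c p,
      HSet {hpair (c p) (c q) |p q. p \<in> P \<and> q \<in> P \<and> p \<subseteq> q}} \<union> range (\<lambda>n. HSet (c ` D n))"]
    by auto
  have "\<exists>q\<in>P. q \<subseteq> p \<and> generic_condition P (\<subseteq>) c M q"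
    using assms(5) M(1-5) p inj_on_subset[OF c subset_UNIV, of P]
    unfolding proper_forcing_def P_def I_def by blast
  then obtain q where q: "q \<in> P" "q \<subseteq> p" and generic: "generic_condition P (\<subseteq>) c M q" by blast
  define C where "C = {d. c d \<in> M}"
  have "countable C"
  proof (rule countable_image_inj_on)
    show "countable (c ` C)" by (rule countable_subset[OF _ M(1)]) (auto simp: C_def)
    show "inj_on c C" using c by (rule inj_on_subset) simp
  qed
  have predense: "\<exists>d\<in>D n \<inter> C. \<exists>s\<in>P. s \<subseteq> r \<and> s \<subseteq> d" if "r \<in> P" "r \<subseteq> q" for n r
  proof -
    have "predense_below P (\<subseteq>) q {d \<in> D n. c d \<in> M}"
      using generic D M(6) unfolding generic_condition_def by blast
    moreover have "{d \<in> D n. c d \<in> M} = D n \<inter> C" unfolding C_def by blast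
    ultimately show ?thesis using that unfolding predense_below_def by simp
  qed
  \<comment> \<open>The conditions of the model are countably many, so those that decide bit
    \<open>n\<close> as \<open>b\<close> have a Borel union.\<close>
  define Z where "Z n b = \<Union>(dec n b \<inter> C)" for n b
  have Z: "Z n b \<in> sets borel" for n b
    unfolding Z_def using \<open>countable C\<close> by (intro sets.countable_Union) (auto simp: dec_def P)
  define q' where "q' = q \<inter> (\<Inter>n. Z n True \<union> Z n False)"
  have q'_borel: "q' \<in> sets borel"
    unfolding q'_def using q(1) Z by (intro sets.Int sets.countable_INT' sets.Un) (auto simp: P)
  have "q' \<notin> I"
  proof
    assume "q' \<in> I"
    \<comment> \<open>A positive remainder would have an extension \<open>s\<close> inside some
      \<open>d\<close> in \<open>D n \<inter> C\<close>. Such a \<open>d\<close> either meets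
      \<open>p\<close> in a set of the ideal or is contained in some \<open>Z n b\<close>; in both
      cases \<open>s\<close> is not positive.\<close>
    have rest: "q - (Z n True \<union> Z n False) \<in> I" for n
    proof (rule ccontr)
      assume "q - (Z n True \<union> Z n False) \<notin> I"
      then have "q - (Z n True \<union> Z n False) \<in> P"
        using q(1) Z unfolding P by (blast intro: sets.Diff sets.Un)
      then obtain d s where d: "d \<in> D n" "d \<in> C" and s: "s \<in> P" "s \<subseteq> q - (Z n True \<union> Z n False)" "s \<subseteq> d"
        using predense[of "q - (Z n True \<union> Z n False)" n] by blast
      have "s \<in> I"
      proof (cases "d \<inter> p \<in> I")
        case True
        then show ?thesis using s q(2) by (intro I_subset[OF True]) blast
      next
        case False
        then obtain b where "d \<in> dec n b" using d(1) by (auto simp: D_def)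
        then have "d \<subseteq> Z n True \<union> Z n False"
          using d(2) unfolding Z_def by (cases b) auto
        then have "s \<subseteq> {}" using s by blast
        then show ?thesis using I_subset[OF empty_in_hypergraph_ideal[of \<G>, folded I_def]] by blast
      qed
      then show False using s(1) by (simp add: P)
    qed
    have "(\<Union>n. q - (Z n True \<union> Z n False)) \<in> I"
      unfolding I_def by (intro hypergraph_ideal_UN) (use rest in \<open>simp_all add: I_def\<close>)
    then have "(\<Union>B\<in>{q', \<Union>n. q - (Z n True \<union> Z n False)}. B) \<in> I"
      unfolding I_def by (intro hypergraph_ideal_UN) (use \<open>q' \<in> I\<close> in \<open>auto simp: I_def\<close>)
    then have "q \<in> I" by (rule I_subset) (auto simp: q'_def)
    then show False using q(1) by (simp add: P)
  qed
  have "q' \<subseteq> Z n True \<union> Z n False" for n unfolding q'_def by blast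
  then have "\<exists>b Y. infinite Y \<and> q' \<inter> (\<Inter>n\<in>Y. Z n b) \<notin> I"
    using \<open>q' \<notin> I\<close> unfolding I_def
    by (intro ex_homogeneous[OF assms(1) bspec[OF assms(2)] assms(3) bspec[OF assms(4)] q'_borel _ Z])
  then obtain b Y where Y: "infinite Y" "q' \<inter> (\<Inter>n\<in>Y. Z n b) \<notin> I"
    by (elim exE conjE)
  define r where "r = q' \<inter> (\<Inter>n\<in>Y. Z n b)"
  have r: "r \<in> P"
    using Y(2) Z q'_borel unfolding P r_def by (auto intro!: sets.countable_INT')
  have "r \<subseteq> p" using q(2) by (auto simp: r_def q'_def)
  have "forces_mem P (\<subseteq>) (n, b) \<tau> r" if "n \<in> Y" for n
    unfolding forces_mem_def
  proof (intro ballI impI)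
    fix s assume s: "s \<in> P" "s \<subseteq> r"
    \<comment> \<open>Countably many conditions forcing the bit cover \<open>s\<close>, so one of
      them meets \<open>s\<close> in a positive set, which then forces the bit too.\<close>
    have "s \<subseteq> (\<Union>d\<in>dec n b \<inter> C. s \<inter> d)"
      using s(2) that by (auto simp: r_def Z_def)
    then have "(\<Union>d\<in>dec n b \<inter> C. s \<inter> d) \<notin> I"
      using s(1) I_subset by (auto simp: P)
    then obtain d where d: "d \<in> dec n b" "s \<inter> d \<notin> I"
      using hypergraph_ideal_UN[of "dec n b \<inter> C" "\<lambda>d. s \<inter> d" \<G>] \<open>countable C\<close>
      unfolding I_def by auto
    then have "s \<inter> d \<in> P" using s(1) d(1) unfolding P dec_def by (blast intro: sets.Int)
    then obtain s' where "s' \<in> P" "s' \<subseteq> s \<inter> d" "\<exists>t. ((n, b), t) \<in> \<tau> \<and> s' \<subseteq> t"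
      using d(1) unfolding dec_def forces_mem_def by blast
    then show "\<exists>s'\<in>P. s' \<subseteq> s \<and> (\<exists>t. ((n, b), t) \<in> \<tau> \<and> s' \<subseteq> t)" by blast
  qed
  \<comment> \<open>The function with constant value \<open>b\<close> on \<open>Y\<close> is the
    infinite subfunction in the ground model.\<close>
  moreover define y where "y n = (if n \<in> Y then Some b else None)" for n
  have "dom y = Y" by (auto simp: y_def dom_def)
  have "Map.graph y = {(n, b) | n. n \<in> Y}" by (auto simp: y_def Map.graph_def split: if_splits)
  ultimately have "forces_all (Map.graph y) (\<lambda>e. forces_mem P (\<subseteq>) e \<tau>) r"
    unfolding forces_all_def by auto
  moreover have "forces_not P (\<subseteq>) (forces_all (Map.graph y) (\<lambda>e. forces_mem P (\<subseteq>) e \<tau>)) p"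
    using independent Y(1) \<open>dom y = Y\<close> unfolding forces_independent_def forces_all_def by simp
  ultimately show False using r \<open>r \<subseteq> p\<close> unfolding forces_not_def by blast
qed

end
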